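(* Let $\mathbb{K}$ be a definably complete expansion of an ordered field $\langle K,<,+,\cdot\rangle$. Then either (I) $f(D)$ is nowhere dense (in $K$) for every $n$, every definable discrete set $D\subseteq K^n$ and every definable function $f:K^n\to K$, or (II) $\mathbb{K}$ defines a discrete subring (i.e. there is a definable subset of $K$ that is a subring of $K$ and is discrete).
   Context: An expansion $\mathbb{K}$ of an ordered field $\langle K,<,+,\cdot\rangle$ is definably complete if every nonempty bounded subset of $K$ definable in $\mathbb{K}$ has a supremum in $K$. "Definable" means definable in $\mathbb{K}$ with parameters from $K$. $K$ carries the order topology and $K^n$ the product topology. All rings have a unit, so subrings of $K$ contain $1$. *)

theory Defs
  imports "HOL-Analysis.Analysis" "HOL-Library.Lub_Glb"
begin

section \<open>Expansions of an ordered field and their first-order formulas\<close>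

text \<open>
  An expansion is given by the interpretation of the additional function and relation symbols;
  the symbols for order, addition and multiplication are built into the syntax below and always
  denote the operations of the type class. The underlying ordered field is the whole type \<^typ>\<open>'a\<close>.

  No arity function is needed: a symbol \<open>s\<close> applied to a list of \<open>k\<close> arguments plays the role of a
  \<open>k\<close>-ary symbol \<open>(s, k)\<close>. A language in which \<open>s\<close> has the single arity \<open>k\<close> is covered by
  interpreting \<open>s\<close> as constantly \<open>0\<close> (or \<open>False\<close>) on lists of any other length,
  which does not change the definable sets.
\<close>

record ('f, 'r, 'a) expansion =
  fn_interp :: "'f \<Rightarrow> 'a list \<Rightarrow> 'a"
  rel_interp :: "'r \<Rightarrow> 'a list \<Rightarrow> bool"

datatype ('f, 'a) trm =
    Var nat
  | Param 'a
  | Plus "('f, 'a) trm" "('f, 'a) trm"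
  | Times "('f, 'a) trm" "('f, 'a) trm"
  | Fn 'f "('f, 'a) trm list"

datatype ('f, 'r, 'a) fmla =
    Eq "('f, 'a) trm" "('f, 'a) trm"
  | Less "('f, 'a) trm" "('f, 'a) trm"
  | Rel 'r "('f, 'a) trm list"
  | Neg "('f, 'r, 'a) fmla"
  | Conj "('f, 'r, 'a) fmla" "('f, 'r, 'a) fmla"
  | Ex nat "('f, 'r, 'a) fmla"

primrec trm_vars :: "('f, 'a) trm \<Rightarrow> nat set" where
  "trm_vars (Var i) = {i}"
| "trm_vars (Param a) = {}"
| "trm_vars (Plus s t) = trm_vars s \<union> trm_vars t"
| "trm_vars (Times s t) = trm_vars s \<union> trm_vars t"
| "trm_vars (Fn f ts) = \<Union> (set (map trm_vars ts))"

primrec free_vars :: "('f, 'r, 'a) fmla \<Rightarrow> nat set" where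
  "free_vars (Eq s t) = trm_vars s \<union> trm_vars t"
| "free_vars (Less s t) = trm_vars s \<union> trm_vars t"
| "free_vars (Rel r ts) = \<Union> (set (map trm_vars ts))"
| "free_vars (Neg \<phi>) = free_vars \<phi>"
| "free_vars (Conj \<phi> \<psi>) = free_vars \<phi> \<union> free_vars \<psi>"
| "free_vars (Ex i \<phi>) = free_vars \<phi> - {i}"

primrec trm_val ::
  "('f, 'r, 'a::linordered_field) expansion \<Rightarrow> (nat \<Rightarrow> 'a) \<Rightarrow> ('f, 'a) trm \<Rightarrow> 'a" where
  "trm_val K e (Var i) = e i"
| "trm_val K e (Param a) = a"
| "trm_val K e (Plus s t) = trm_val K e s + trm_val K e t"
| "trm_val K e (Times s t) = trm_val K e s * trm_val K e t"
| "trm_val K e (Fn f ts) = fn_interp K f (map (trm_val K e) ts)"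

primrec holds ::
  "('f, 'r, 'a::linordered_field) expansion \<Rightarrow> (nat \<Rightarrow> 'a) \<Rightarrow> ('f, 'r, 'a) fmla \<Rightarrow> bool" where
  "holds K e (Eq s t) \<longleftrightarrow> trm_val K e s = trm_val K e t"
| "holds K e (Less s t) \<longleftrightarrow> trm_val K e s < trm_val K e t"
| "holds K e (Rel r ts) \<longleftrightarrow> rel_interp K r (map (trm_val K e) ts)"
| "holds K e (Neg \<phi>) \<longleftrightarrow> \<not> holds K e \<phi>"
| "holds K e (Conj \<phi> \<psi>) \<longleftrightarrow> holds K e \<phi> \<and> holds K e \<psi>"
| "holds K e (Ex i \<phi>) \<longleftrightarrow> (\<exists>a. holds K (e(i := a)) \<phi>)"


section \<open>Definability with parameters\<close>

text \<open>
  The power \<open>K\<^sup>n\<close> consists of the extensional functions on \<open>{..<n}\<close>; it is the carrier of the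
  product topology \<open>power_top n\<close> below.
\<close>

definition power_set :: "nat \<Rightarrow> (nat \<Rightarrow> 'a) set" where
  "power_set n = {..<n} \<rightarrow>\<^sub>E UNIV"

definition definable ::
  "('f, 'r, 'a::linordered_field) expansion \<Rightarrow> nat \<Rightarrow> (nat \<Rightarrow> 'a) set \<Rightarrow> bool" where
  "definable K n X \<longleftrightarrow>
     (\<exists>\<phi> :: ('f, 'r, 'a) fmla. free_vars \<phi> \<subseteq> {..<n} \<and> X = {x \<in> power_set n. holds K x \<phi>})"

text \<open>Subsets of \<open>K\<close> itself, where \<open>K\<close> is identified with \<open>K\<^sup>1\<close>.\<close>

definition definable1 ::
  "('f, 'r, 'a::linordered_field) expansion \<Rightarrow> 'a set \<Rightarrow> bool" where
  "definable1 K X \<longleftrightarrow> definable K 1 {x \<in> power_set 1. x 0 \<in> X}"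

text \<open>
  A function \<open>K\<^sup>n \<rightarrow> K\<close> is definable if its graph, a subset of \<open>K\<^sup>n\<^sup>+\<^sup>1\<close>, is; the values of \<open>f\<close> outside
  \<^term>\<open>power_set n\<close> are irrelevant.
\<close>

definition definable_fun ::
  "('f, 'r, 'a::linordered_field) expansion \<Rightarrow> nat \<Rightarrow> ((nat \<Rightarrow> 'a) \<Rightarrow> 'a) \<Rightarrow> bool" where
  "definable_fun K n f \<longleftrightarrow>
     definable K (Suc n) {x \<in> power_set (Suc n). x n = f (restrict x {..<n})}"

definition definably_complete :: "('f, 'r, 'a::linordered_field) expansion \<Rightarrow> bool" where
  "definably_complete K \<longleftrightarrow>
     (\<forall>X. definable1 K X \<and> X \<noteq> {} \<and> bdd_above X \<and> bdd_below X \<longrightarrow> (\<exists>s. isLub UNIV X s))"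


section \<open>Topology and subrings\<close>

text \<open>
  On a type of class \<^class>\<open>linorder_topology\<close>, \<^term>\<open>euclidean\<close> is the order topology.
\<close>

definition power_top :: "nat \<Rightarrow> (nat \<Rightarrow> 'a::linorder_topology) topology" where
  "power_top n = product_topology (\<lambda>_. euclidean) {..<n}"

definition discrete_in_power :: "nat \<Rightarrow> (nat \<Rightarrow> 'a::linorder_topology) set \<Rightarrow> bool" where
  "discrete_in_power n D \<longleftrightarrow>
     D \<subseteq> power_set n \<and> subtopology (power_top n) D = discrete_topology D"

definition nowhere_dense :: "'a::topological_space set \<Rightarrow> bool" where
  "nowhere_dense S \<longleftrightarrow> interior (closure S) = {}"

definition unital_subring :: "'a::ring_1 set \<Rightarrow> bool" where
  "unital_subring R \<longleftrightarrow>
     0 \<in> R \<and> 1 \<in> R \<and> (\<forall>x\<in>R. - x \<in> R) \<and> (\<forall>x\<in>R. \<forall>y\<in>R. x + y \<in> R \<and> x * y \<in> R)"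

end

theory Submission
  imports Defs
begin

text \<open>
  Suppose that the first alternative fails, so that \<open>f(D)\<close> is somewhere dense. Bounded and uniformly
  separated definable sets play the part of finite sets in a definably complete field: they are
  called pseudo-finite here, their images under definable functions are again of this kind
  (\<open>pseudofinite_image\<close>), and their nonempty definable subsets have least elements for every
  definable linear order (\<open>pseudofinite_least\<close>). A definable discrete set \<open>D\<close> is the increasing
  union of pseudo-finite subsets, so some interval contains a dense set of points that are born in
  the course of time, only pseudo-finitely many up to each moment (\<open>dense_image_exhaustion\<close>).

  Such a set can be used as a memory. Attach to each point \<open>z\<close> an interval to its right that is much
  shorter than all distances between points born so far. A point \<open>x\<close> then codes the sequence of
  earlier points whose intervals contain \<open>x\<close>. For each point of this sequence, the ratio of the
  length of its interval to the distance from the next point of the sequence is a number that can be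
  prescribed with any given precision. The decisive fact is that every code can be prolonged by one more number of one's choice
  (\<open>code_extend\<close>).

  Now let a code list approximations to \<open>2, 3, \<dots>, n\<close>. A recursion along the natural numbers is not
  possible within \<open>K\<close>, but it is not necessary either: the set of all numbers reached by codes with
  every precision is definable, contains \<open>2\<close>, is closed under adding \<open>1\<close> since codes can be prolonged,
  and has gaps at least \<open>1\<close> since any code of high precision tells its elements apart
  (\<open>definable_progression\<close>). Definable completeness gives induction on such a set, and with it
  the usual proofs that the set generates a discrete subring (\<open>discrete_subring_of_progression\<close>).
\<close>

section \<open>Definable predicates and functions\<close>

text \<open>
  Definability is handled semantically: a predicate on environments is definable if some formula,
  with parameters and any finite number of variables, expresses it. A concrete relation such as
  \<open>P x y\<close> enters as \<open>\<lambda>e. P (e 0) (e 1)\<close>, and its definability is then proved by resolution with the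
  closure rules below, without ever writing down a formula. A function is definable if its graph is,
  where the value is put in front of the arguments.
\<close>

definition dpred :: "('f, 'r, 'a::linordered_field) expansion \<Rightarrow> ((nat \<Rightarrow> 'a) \<Rightarrow> bool) \<Rightarrow> bool" where
  "dpred K P \<longleftrightarrow> (\<exists>\<phi>. \<forall>e. holds K e \<phi> \<longleftrightarrow> P e)"

definition dfun :: "('f, 'r, 'a::linordered_field) expansion \<Rightarrow> ((nat \<Rightarrow> 'a) \<Rightarrow> 'a) \<Rightarrow> bool" where
  "dfun K t \<longleftrightarrow> dpred K (\<lambda>e. e 0 = t (\<lambda>i. e (Suc i)))"

lemma finite_trm_vars [simp]: "finite (trm_vars t)"
  by (induction t) auto

lemma finite_free_vars [simp]: "finite (free_vars \<phi>)"
  by (induction \<phi>) auto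

lemma trm_val_cong: "(\<And>i. i \<in> trm_vars t \<Longrightarrow> e i = e' i) \<Longrightarrow> trm_val K e t = trm_val K e' t"
proof (induction t)
  case (Fn f ts)
  then have "map (trm_val K e) ts = map (trm_val K e') ts"
    by (intro map_cong) auto
  then show ?case by (simp only: trm_val.simps)
qed simp_all

lemma holds_cong: "(\<And>i. i \<in> free_vars \<phi> \<Longrightarrow> e i = e' i) \<Longrightarrow> holds K e \<phi> = holds K e' \<phi>"
proof (induction \<phi> arbitrary: e e')
  case (Eq s t)
  then show ?case using trm_val_cong[of s e e' K] trm_val_cong[of t e e' K] by simp
next
  case (Less s t)
  then show ?case using trm_val_cong[of s e e' K] trm_val_cong[of t e e' K] by simp
next
  case (Rel r ts)
  have "map (trm_val K e) ts = map (trm_val K e') ts"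
    by (intro map_cong trm_val_cong) (use Rel in auto)
  then show ?case by (simp only: holds.simps)
next
  case (Neg \<phi>)
  have "holds K e \<phi> = holds K e' \<phi>"
    by (rule Neg.IH) (use Neg.prems in simp)
  then show ?case by simp
next
  case (Conj \<phi> \<psi>)
  have "holds K e \<phi> = holds K e' \<phi>" "holds K e \<psi> = holds K e' \<psi>"
    by (rule Conj.IH(1), use Conj.prems in simp) (rule Conj.IH(2), use Conj.prems in simp)
  then show ?case by simp
next
  case (Ex j \<phi>)
  have "holds K (e(j := a)) \<phi> = holds K (e'(j := a)) \<phi>" for a
    by (rule Ex.IH) (use Ex.prems in auto)
  then show ?case by simp
qed

lemma trm_rename: "\<exists>t'. \<forall>e. trm_val K e t' = trm_val K (\<lambda>i. e (\<sigma> i)) t"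
proof (induction t)
  case (Var i)
  show ?case by (rule exI[of _ "Var (\<sigma> i)"]) simp
next
  case (Param a)
  show ?case by (rule exI[of _ "Param a"]) simp
next
  case (Plus s t)
  then obtain s' t' where "\<forall>e. trm_val K e s' = trm_val K (\<lambda>i. e (\<sigma> i)) s"
    "\<forall>e. trm_val K e t' = trm_val K (\<lambda>i. e (\<sigma> i)) t" by blast
  then show ?case by (intro exI[of _ "Plus s' t'"]) simp
next
  case (Times s t)
  then obtain s' t' where "\<forall>e. trm_val K e s' = trm_val K (\<lambda>i. e (\<sigma> i)) s"
    "\<forall>e. trm_val K e t' = trm_val K (\<lambda>i. e (\<sigma> i)) t" by blast
  then show ?case by (intro exI[of _ "Times s' t'"]) simp
next
  case (Fn f ts)
  then have "\<forall>t\<in>set ts. \<exists>t'. \<forall>e. trm_val K e t' = trm_val K (\<lambda>i. e (\<sigma> i)) t" by blast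
  from bchoice[OF this] obtain g
    where g: "\<forall>t\<in>set ts. \<forall>e. trm_val K e (g t) = trm_val K (\<lambda>i. e (\<sigma> i)) t" ..
  have "map (trm_val K e) (map g ts) = map (trm_val K (\<lambda>i. e (\<sigma> i))) ts" for e
    using g by simp
  then show ?case by (intro exI[of _ "Fn f (map g ts)"]) (simp only: trm_val.simps simp_thms)
qed

lemma trms_rename:
  "\<exists>ts'. \<forall>e. map (trm_val K e) ts' = map (trm_val K (\<lambda>i. e (\<sigma> i))) ts"
proof -
  have "\<forall>t. \<exists>t'. \<forall>e. trm_val K e t' = trm_val K (\<lambda>i. e (\<sigma> i)) t" by (simp add: trm_rename)
  from choice[OF this] obtain g where "\<forall>t e. trm_val K e (g t) = trm_val K (\<lambda>i. e (\<sigma> i)) t" ..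
  then show ?thesis by (intro exI[of _ "map g ts"]) simp
qed

text \<open>
  Renaming may capture, so a bound variable is first moved to an index outside the image of the
  free variables. This is why the induction is over all renamings at once.
\<close>

lemma fmla_rename: "\<exists>\<phi>'. \<forall>e. holds K e \<phi>' = holds K (\<lambda>i. e (\<sigma> i)) \<phi>"
proof (induction \<phi> arbitrary: \<sigma>)
  case (Eq s t)
  obtain s' t' where "\<forall>e. trm_val K e s' = trm_val K (\<lambda>i. e (\<sigma> i)) s"
    "\<forall>e. trm_val K e t' = trm_val K (\<lambda>i. e (\<sigma> i)) t" using trm_rename by metis
  then show ?case by (intro exI[of _ "Eq s' t'"]) simp
next
  case (Less s t)
  obtain s' t' where "\<forall>e. trm_val K e s' = trm_val K (\<lambda>i. e (\<sigma> i)) s"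
    "\<forall>e. trm_val K e t' = trm_val K (\<lambda>i. e (\<sigma> i)) t" using trm_rename by metis
  then show ?case by (intro exI[of _ "Less s' t'"]) simp
next
  case (Rel r ts)
  obtain ts' where "\<forall>e. map (trm_val K e) ts' = map (trm_val K (\<lambda>i. e (\<sigma> i))) ts"
    using trms_rename by metis
  then show ?case by (intro exI[of _ "Rel r ts'"]) (simp only: holds.simps simp_thms)
next
  case (Neg \<phi>)
  then obtain \<phi>' where "\<forall>e. holds K e \<phi>' = holds K (\<lambda>i. e (\<sigma> i)) \<phi>" by blast
  then show ?case by (intro exI[of _ "Neg \<phi>'"]) simp
next
  case (Conj \<phi> \<psi>)
  then obtain \<phi>' \<psi>' where "\<forall>e. holds K e \<phi>' = holds K (\<lambda>i. e (\<sigma> i)) \<phi>"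
    "\<forall>e. holds K e \<psi>' = holds K (\<lambda>i. e (\<sigma> i)) \<psi>" by metis
  then show ?case by (intro exI[of _ "Conj \<phi>' \<psi>'"]) simp
next
  case (Ex j \<phi>)
  obtain k where k: "k \<notin> \<sigma> ` free_vars \<phi>"
    using ex_new_if_finite[OF infinite_UNIV_nat] by (meson finite_free_vars finite_imageI)
  obtain \<phi>' where \<phi>': "\<forall>e. holds K e \<phi>' = holds K (\<lambda>i. e ((\<sigma>(j := k)) i)) \<phi>"
    using Ex by blast
  have "holds K (\<lambda>i. (e(k := a)) ((\<sigma>(j := k)) i)) \<phi> = holds K ((\<lambda>i. e (\<sigma> i))(j := a)) \<phi>" for e a
    by (rule holds_cong) (use k in auto)
  then show ?case using \<phi>' by (intro exI[of _ "Ex k \<phi>'"]) simp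
qed

lemma dpredI: "(\<And>e. holds K e \<phi> \<longleftrightarrow> P e) \<Longrightarrow> dpred K P"
  unfolding dpred_def by (intro exI[of _ \<phi>] allI)

lemma dpred_rename:
  assumes "dpred K P"
  shows "dpred K (\<lambda>e. P (\<lambda>i. e (\<sigma> i)))"
proof -
  from assms obtain \<phi> where \<phi>: "\<forall>e. holds K e \<phi> \<longleftrightarrow> P e" unfolding dpred_def ..
  from fmla_rename[of K \<sigma> \<phi>] obtain \<psi> where "\<forall>e. holds K e \<psi> = holds K (\<lambda>i. e (\<sigma> i)) \<phi>" ..
  then show ?thesis using \<phi> by (intro dpredI[of K \<psi>]) simp
qed

lemma dpred_not:
  assumes "dpred K P"
  shows "dpred K (\<lambda>e. \<not> P e)"
proof -
  from assms obtain \<phi> where "\<forall>e. holds K e \<phi> \<longleftrightarrow> P e" unfolding dpred_def ..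
  then show ?thesis by (intro dpredI[of K "Neg \<phi>"]) simp
qed

lemma dpred_conj:
  assumes "dpred K P" "dpred K Q"
  shows "dpred K (\<lambda>e. P e \<and> Q e)"
proof -
  from assms(1) obtain \<phi> where \<phi>: "\<forall>e. holds K e \<phi> \<longleftrightarrow> P e" unfolding dpred_def ..
  from assms(2) obtain \<psi> where \<psi>: "\<forall>e. holds K e \<psi> \<longleftrightarrow> Q e" unfolding dpred_def ..
  show ?thesis by (rule dpredI[of K "Conj \<phi> \<psi>"]) (simp add: \<phi> \<psi>)
qed

lemma dpred_disj:
  assumes "dpred K P" "dpred K Q"
  shows "dpred K (\<lambda>e. P e \<or> Q e)"
proof -
  have "dpred K (\<lambda>e. \<not> (\<not> P e \<and> \<not> Q e))" by (intro dpred_not dpred_conj assms)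
  then show ?thesis by simp
qed

lemma dpred_imp:
  assumes "dpred K P" "dpred K Q"
  shows "dpred K (\<lambda>e. P e \<longrightarrow> Q e)"
proof -
  have "dpred K (\<lambda>e. \<not> P e \<or> Q e)" by (intro dpred_not dpred_disj assms)
  then show ?thesis by (simp only: imp_conv_disj)
qed

lemma dpred_iff:
  assumes "dpred K P" "dpred K Q"
  shows "dpred K (\<lambda>e. P e \<longleftrightarrow> Q e)"
proof -
  have "dpred K (\<lambda>e. (P e \<longrightarrow> Q e) \<and> (Q e \<longrightarrow> P e))" by (intro dpred_conj dpred_imp assms)
  then show ?thesis by (simp only: iff_conv_conj_imp)
qed

lemma dpred_const: "dpred K (\<lambda>e. b)"
proof (cases b)
  case True
  then show ?thesis by (intro dpredI[of K "Eq (Param 0) (Param 0)"]) simp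
next
  case False
  then show ?thesis by (intro dpredI[of K "Neg (Eq (Param 0) (Param 0))"]) simp
qed

text \<open>
  The bound variable is pushed in front of the environment and becomes its entry \<open>0\<close>. The premise is
  again about a predicate on environments, so that the closure rules apply to it in turn.
\<close>

lemma dpred_ex:
  assumes "dpred K (\<lambda>e. Q (\<lambda>i. e (Suc i)) (e 0))"
  shows "dpred K (\<lambda>e. \<exists>a. Q e a)"
proof -
  from assms obtain \<phi> where \<phi>: "\<forall>e. holds K e \<phi> \<longleftrightarrow> Q (\<lambda>i. e (Suc i)) (e 0)"
    unfolding dpred_def ..
  from finite_free_vars[of \<phi>] obtain k where k: "\<forall>i\<in>free_vars \<phi>. i < k"
    unfolding finite_nat_set_iff_bounded ..
  from fmla_rename[of K "case_nat k (\<lambda>j. j)" \<phi>]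
  obtain \<psi> where \<psi>: "\<forall>e. holds K e \<psi> = holds K (\<lambda>i. e (case i of 0 \<Rightarrow> k | Suc j \<Rightarrow> j)) \<phi>" ..
  have "holds K (\<lambda>i. (e(k := a)) (case i of 0 \<Rightarrow> k | Suc j \<Rightarrow> j)) \<phi>
      = holds K (\<lambda>i. case i of 0 \<Rightarrow> a | Suc j \<Rightarrow> e j) \<phi>" for e a
  proof (rule holds_cong)
    fix i assume "i \<in> free_vars \<phi>"
    with k have "i < k" by blast
    then show "(e(k := a)) (case i of 0 \<Rightarrow> k | Suc j \<Rightarrow> j) = (case i of 0 \<Rightarrow> a | Suc j \<Rightarrow> e j)"
      by (cases i) auto
  qed
  then have "holds K e (Ex k \<psi>) \<longleftrightarrow> (\<exists>a. Q e a)" for e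
    by (simp add: \<psi> \<phi>)
  then show ?thesis by (rule dpredI)
qed

lemma dpred_all:
  assumes "dpred K (\<lambda>e. Q (\<lambda>i. e (Suc i)) (e 0))"
  shows "dpred K (\<lambda>e. \<forall>a. Q e a)"
proof -
  have "dpred K (\<lambda>e. \<not> (\<exists>a. \<not> Q e a))" by (intro dpred_not dpred_ex assms)
  then show ?thesis by simp
qed

lemma dpred_all_less:
  "(\<And>i. i < n \<Longrightarrow> dpred K (P i)) \<Longrightarrow> dpred K (\<lambda>e. \<forall>i<n. P i e)" for n :: nat
proof (induction n)
  case (Suc n)
  then have "dpred K (\<lambda>e. (\<forall>i<n. P i e) \<and> P n e)" by (intro dpred_conj) auto
  moreover have "(\<forall>i<Suc n. P i e) \<longleftrightarrow> (\<forall>i<n. P i e) \<and> P n e" for e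
    using less_Suc_eq by auto
  ultimately show ?case by simp
qed (simp add: dpred_const)

lemma dfun_var: "dfun K (\<lambda>e. e i)"
  unfolding dfun_def by (rule dpredI[of _ "Eq (Var 0) (Var (Suc i))"]) simp

lemma dfun_const: "dfun K (\<lambda>e. c)"
  unfolding dfun_def by (rule dpredI[of _ "Eq (Var 0) (Param c)"]) simp

lemma dpred_subst1:
  assumes "dpred K (\<lambda>e. P (e 0))" "dfun K s"
  shows "dpred K (\<lambda>e. P (s e))"
proof -
  have "dpred K (\<lambda>e. \<exists>a. a = s e \<and> P a)"
    using assms unfolding dfun_def by (intro dpred_ex dpred_conj)
  then show ?thesis by simp
qed

lemma dpred_subst2:
  assumes "dpred K (\<lambda>e. P (e 0) (e 1))" "dfun K s" "dfun K t"
  shows "dpred K (\<lambda>e. P (s e) (t e))"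
proof -
  have t: "dpred K (\<lambda>e. e 1 = t (\<lambda>i. e (Suc (Suc i))))"
    using dpred_rename[OF assms(3)[unfolded dfun_def], of "\<lambda>i. Suc i"] by simp
  have s: "dpred K (\<lambda>e. e 0 = s (\<lambda>i. e (Suc (Suc i))))"
    using dpred_rename[OF assms(2)[unfolded dfun_def], of "\<lambda>i. case i of 0 \<Rightarrow> 0 | Suc j \<Rightarrow> Suc (Suc j)"] by simp
  have "dpred K (\<lambda>e. \<exists>b a. a = s e \<and> b = t e \<and> P a b)"
    using s t assms(1) by (intro dpred_ex dpred_conj) simp_all
  then show ?thesis by simp
qed

lemma dfun_graph:
  assumes "dfun K s"
  shows "dpred K (\<lambda>e. e k = s (\<lambda>i. e (\<sigma> i)))"
proof -
  have "dpred K (\<lambda>e. e (case 0 of 0 \<Rightarrow> k | Suc j \<Rightarrow> \<sigma> j)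
      = s (\<lambda>i. e (case Suc i of 0 \<Rightarrow> k | Suc j \<Rightarrow> \<sigma> j)))"
    using assms unfolding dfun_def by (rule dpred_rename)
  then show ?thesis by simp
qed

lemma dpred_subst3:
  assumes "dpred K (\<lambda>e. P (e 0) (e 1) (e 2))" "dfun K s" "dfun K t" "dfun K u"
  shows "dpred K (\<lambda>e. P (s e) (t e) (u e))"
proof -
  have "dpred K (\<lambda>e. e 0 = s (\<lambda>i. e (Suc (Suc (Suc i)))))"
    "dpred K (\<lambda>e. e (Suc 0) = t (\<lambda>i. e (Suc (Suc (Suc i)))))"
    "dpred K (\<lambda>e. e (Suc (Suc 0)) = u (\<lambda>i. e (Suc (Suc (Suc i)))))"
    using assms by (auto intro: dfun_graph)
  moreover have "dpred K (\<lambda>e. P (e 0) (e (Suc 0)) (e (Suc (Suc 0))))"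
    using assms(1) by (simp add: numeral_2_eq_2)
  ultimately have "dpred K (\<lambda>e. \<exists>c b a. a = s e \<and> b = t e \<and> c = u e \<and> P a b c)"
    by (intro dpred_ex dpred_conj)
  then show ?thesis by simp
qed

lemma dpred_less: "dfun K s \<Longrightarrow> dfun K t \<Longrightarrow> dpred K (\<lambda>e. s e < t e)"
  by (rule dpred_subst2) (auto intro!: dpredI[of K "Less (Var 0) (Var 1)"])

lemma dpred_eq: "dfun K s \<Longrightarrow> dfun K t \<Longrightarrow> dpred K (\<lambda>e. s e = t e)"
  by (rule dpred_subst2) (auto intro!: dpredI[of K "Eq (Var 0) (Var 1)"])

lemma dpred_le:
  assumes "dfun K s" "dfun K t"
  shows "dpred K (\<lambda>e. s e \<le> t e)"
proof -
  have "dpred K (\<lambda>e. \<not> t e < s e)" by (intro dpred_not dpred_less assms)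
  then show ?thesis by (simp add: not_less)
qed

lemma dfun_comp1:
  assumes "dpred K (\<lambda>e. e 0 = F (e 1))" "dfun K s"
  shows "dfun K (\<lambda>e. F (s e))"
  unfolding dfun_def
proof (rule dpred_subst2[of K "\<lambda>x y. x = F y", OF assms(1) dfun_var])
  show "dfun K (\<lambda>e. s (\<lambda>i. e (Suc i)))"
    unfolding dfun_def by (rule dfun_graph[OF assms(2)])
qed

lemma dfun_comp2:
  assumes "dpred K (\<lambda>e. e 0 = F (e 1) (e 2))" "dfun K s" "dfun K t"
  shows "dfun K (\<lambda>e. F (s e) (t e))"
  unfolding dfun_def
proof (rule dpred_subst3[of K "\<lambda>x y z. x = F y z", OF assms(1) dfun_var])
  show "dfun K (\<lambda>e. s (\<lambda>i. e (Suc i)))" "dfun K (\<lambda>e. t (\<lambda>i. e (Suc i)))"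
    unfolding dfun_def by (rule dfun_graph[OF assms(2)], rule dfun_graph[OF assms(3)])
qed

lemma dfun_plus: "dfun K s \<Longrightarrow> dfun K t \<Longrightarrow> dfun K (\<lambda>e. s e + t e)"
  by (rule dfun_comp2) (auto intro!: dpredI[of K "Eq (Var 0) (Plus (Var 1) (Var 2))"])

lemma dfun_times: "dfun K s \<Longrightarrow> dfun K t \<Longrightarrow> dfun K (\<lambda>e. s e * t e)"
  by (rule dfun_comp2) (auto intro!: dpredI[of K "Eq (Var 0) (Times (Var 1) (Var 2))"])

lemma dfun_uminus:
  assumes "dfun K s"
  shows "dfun K (\<lambda>e. - s e)"
proof -
  have "dfun K (\<lambda>e. (- 1) * s e)" by (intro dfun_times dfun_const assms)
  then show ?thesis by simp
qed

lemma dfun_minus: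
  assumes "dfun K s" "dfun K t"
  shows "dfun K (\<lambda>e. s e - t e)"
proof -
  have "dfun K (\<lambda>e. s e + - t e)" by (intro dfun_plus dfun_uminus assms)
  then show ?thesis by simp
qed

lemma dfun_divide:
  assumes "dfun K s" "dfun K t"
  shows "dfun K (\<lambda>e. s e / t e)"
proof (rule dfun_comp2[OF _ assms])
  have "dpred K (\<lambda>e. (e 2 = 0 \<and> e 0 = 0) \<or> (e 2 \<noteq> 0 \<and> e 0 * e 2 = e 1))"
    by (intro dpred_disj dpred_conj dpred_not dpred_eq dfun_times dfun_var dfun_const)
  moreover have "x = y / z \<longleftrightarrow> (z = 0 \<and> x = 0) \<or> (z \<noteq> 0 \<and> x * z = y)" for x y z :: 'c
    by (cases "z = 0") (auto simp: eq_divide_eq)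
  ultimately show "dpred K (\<lambda>e. e 0 = e 1 / e 2)" by simp
qed

lemma dfun_abs:
  assumes "dfun K s"
  shows "dfun K (\<lambda>e. \<bar>s e\<bar>)"
proof (rule dfun_comp1[OF _ assms])
  have "dpred K (\<lambda>e. (0 \<le> e 1 \<and> e 0 = e 1) \<or> (e 1 < 0 \<and> e 0 = - e 1))"
    by (intro dpred_disj dpred_conj dpred_le dpred_less dpred_eq dfun_uminus dfun_var dfun_const)
  moreover have "x = \<bar>y\<bar> \<longleftrightarrow> (0 \<le> y \<and> x = y) \<or> (y < 0 \<and> x = - y)" for x y :: 'c
    by auto
  ultimately show "dpred K (\<lambda>e. e 0 = \<bar>e 1\<bar>)" by simp
qed

lemmas def_intros =
  dpred_not dpred_conj dpred_disj dpred_imp dpred_iff dpred_ex dpred_all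
  dpred_less dpred_le dpred_eq dfun_plus dfun_times dfun_uminus dfun_minus dfun_divide dfun_abs
  dfun_var dfun_const

lemma fmla_ex_set:
  assumes "finite F"
  shows "\<exists>\<psi>. free_vars \<psi> = free_vars \<phi> - F \<and>
    (\<forall>e. holds K e \<psi> \<longleftrightarrow> (\<exists>e'. (\<forall>i. i \<notin> F \<longrightarrow> e' i = e i) \<and> holds K e' \<phi>))"
  using assms
proof (induction F)
  case empty
  have "(\<forall>i. e' i = e i) \<longleftrightarrow> e' = e" for e e' :: "nat \<Rightarrow> 'c" by auto
  then show ?case by (intro exI[of _ \<phi>]) simp
next
  case (insert j F)
  then obtain \<psi> where \<psi>: "free_vars \<psi> = free_vars \<phi> - F"
    "\<forall>e. holds K e \<psi> \<longleftrightarrow> (\<exists>e'. (\<forall>i. i \<notin> F \<longrightarrow> e' i = e i) \<and> holds K e' \<phi>)" by blast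
  have "(\<exists>a. \<exists>e'. (\<forall>i. i \<notin> F \<longrightarrow> e' i = (e(j := a)) i) \<and> holds K e' \<phi>) \<longleftrightarrow>
      (\<exists>e'. (\<forall>i. i \<notin> insert j F \<longrightarrow> e' i = e i) \<and> holds K e' \<phi>)" (is "?l \<longleftrightarrow> ?r") for e
  proof
    assume ?l
    then show ?r by (metis fun_upd_other insert_iff)
  next
    assume ?r
    then obtain e' where e': "\<forall>i. i \<notin> insert j F \<longrightarrow> e' i = e i" "holds K e' \<phi>" by blast
    then have "\<forall>i. i \<notin> F \<longrightarrow> e' i = (e(j := e' j)) i" by simp
    with e'(2) show ?l by blast
  qed
  with \<psi> show ?case by (intro exI[of _ "Ex j \<psi>"]) auto
qed

text \<open>
  Only finitely many entries of an environment matter to a formula, so quantifying over whole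
  environments stays first order; this is how quantifiers over \<open>K\<^sup>n\<close> are handled.
\<close>

lemma dpred_ex_env:
  assumes "dpred K P"
  shows "dpred K (\<lambda>e. \<exists>e'. (\<forall>i<k. e' i = e i) \<and> P e')"
proof -
  from assms obtain \<phi> where \<phi>: "\<forall>e. holds K e \<phi> \<longleftrightarrow> P e" unfolding dpred_def ..
  let ?F = "free_vars \<phi> - {..<k}"
  obtain \<psi> where \<psi>: "\<forall>e. holds K e \<psi> \<longleftrightarrow> (\<exists>e'. (\<forall>i. i \<notin> ?F \<longrightarrow> e' i = e i) \<and> holds K e' \<phi>)"
    using fmla_ex_set[of ?F \<phi> K] by auto
  have "holds K e \<psi> \<longleftrightarrow> (\<exists>e'. (\<forall>i<k. e' i = e i) \<and> P e')" (is "_ \<longleftrightarrow> ?r") for e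
  proof
    assume "holds K e \<psi>"
    then obtain e' where "\<forall>i. i \<notin> ?F \<longrightarrow> e' i = e i" "holds K e' \<phi>" using \<psi> by blast
    then show ?r using \<phi> by (intro exI[of _ e']) auto
  next
    assume ?r
    then obtain e' where e': "\<forall>i<k. e' i = e i" "P e'" by blast
    define e'' where "e'' = (\<lambda>i. if i \<in> ?F then e' i else e i)"
    have "holds K e'' \<phi> = holds K e' \<phi>"
      by (rule holds_cong) (use e'(1) in \<open>auto simp: e''_def\<close>)
    then have "holds K e'' \<phi>" using \<phi> e'(2) by simp
    moreover have "\<forall>i. i \<notin> ?F \<longrightarrow> e'' i = e i" by (simp add: e''_def)
    ultimately show "holds K e \<psi>" using \<psi> by blast
  qed
  then show ?thesis by (rule dpredI)
qed

text \<open>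
  The two directions of the passage between definable sets of tuples and definable predicates of
  environments, the second one for subsets of \<open>K\<close> only. There, superfluous variables of the formula
  are quantified away.
\<close>

lemma definable_dpred:
  assumes "definable K n X"
  shows "dpred K (\<lambda>e. restrict e {..<n} \<in> X)"
proof -
  obtain \<phi> where \<phi>: "free_vars \<phi> \<subseteq> {..<n}" "X = {x \<in> power_set n. holds K x \<phi>}"
    using assms unfolding definable_def by blast
  have "holds K e \<phi> \<longleftrightarrow> restrict e {..<n} \<in> X" for e
  proof -
    have "holds K (restrict e {..<n}) \<phi> = holds K e \<phi>"
      by (rule holds_cong) (use \<phi>(1) in auto)
    then show ?thesis unfolding \<phi>(2) by (simp add: power_set_def)
  qed
  then show ?thesis by (rule dpredI)
qed

lemma dpred_definable1:
  assumes "dpred K (\<lambda>e. P (e 0))"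
  shows "definable1 K {x. P x}"
proof -
  from assms obtain \<phi> where \<phi>: "\<forall>e. holds K e \<phi> \<longleftrightarrow> P (e 0)" unfolding dpred_def ..
  let ?F = "free_vars \<phi> - {0}"
  obtain \<psi> where \<psi>: "free_vars \<psi> = free_vars \<phi> - ?F"
    "\<forall>e. holds K e \<psi> \<longleftrightarrow> (\<exists>e'. (\<forall>i. i \<notin> ?F \<longrightarrow> e' i = e i) \<and> holds K e' \<phi>)"
    using fmla_ex_set[of ?F \<phi> K] by auto
  have "holds K e \<psi> \<longleftrightarrow> P (e 0)" for e
  proof
    assume "holds K e \<psi>"
    then show "P (e 0)" using \<psi>(2) \<phi> by auto
  next
    assume "P (e 0)"
    then have "holds K e \<phi>" using \<phi> by simp
    then show "holds K e \<psi>" using \<psi>(2) by blast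
  qed
  moreover have "free_vars \<psi> \<subseteq> {..<1}" using \<psi>(1) by auto
  ultimately show ?thesis unfolding definable1_def definable_def
    by (intro exI[of _ \<psi>]) auto
qed

section \<open>Pseudo-finite sets\<close>

lemma definable_sup:
  assumes "definably_complete K" "dpred K (\<lambda>e. P (e 0))" "P x0" "\<And>x. P x \<Longrightarrow> x \<le> M"
  obtains s where "\<And>x. P x \<Longrightarrow> x \<le> s" "\<And>u. (\<And>x. P x \<Longrightarrow> x \<le> u) \<Longrightarrow> s \<le> u"
proof -
  let ?X = "{x. P x \<and> x0 \<le> x}"
  have "dpred K (\<lambda>e. P (e 0) \<and> x0 \<le> e 0)" by (intro def_intros assms)
  then have "definable1 K ?X" by (rule dpred_definable1)
  moreover have "bdd_above ?X" "bdd_below ?X" "?X \<noteq> {}"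
    using assms(3,4) by (auto intro: bdd_aboveI[of _ M] bdd_belowI[of _ x0])
  ultimately obtain s where s: "isLub UNIV ?X s"
    using assms(1) unfolding definably_complete_def by blast
  show thesis
  proof (rule that)
    show "x \<le> s" if "P x" for x
    proof (cases "x0 \<le> x")
      case True
      then show ?thesis using isLubD2[OF s] that by simp
    next
      case False
      moreover have "x0 \<le> s" using isLubD2[OF s] assms(3) by simp
      ultimately show ?thesis by simp
    qed
    show "s \<le> u" if "\<And>x. P x \<Longrightarrow> x \<le> u" for u
      using s that by (intro isLub_le_isUb[OF s]) (auto simp: isUb_def setle_def)
  qed
qed

text \<open>
  A substitute for induction over the natural numbers, which are not available inside \<open>K\<close>: at the
  supremum of a bounded set closed under a fixed step, one more step would lead beyond it.
\<close>

lemma definable_archimedean: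
  assumes K: "definably_complete K" and P: "dpred K (\<lambda>e. P (e 0))"
    and t0: "P t0" and d: "d > 0" and step: "\<And>t. P t \<Longrightarrow> P (t + d)"
  shows "\<exists>t\<ge>M. P t"
proof (rule ccontr)
  assume "\<not> ?thesis"
  then have M: "\<And>t. P t \<Longrightarrow> t \<le> M" by (meson linear)
  obtain s where s: "\<And>x. P x \<Longrightarrow> x \<le> s" "\<And>u. (\<And>x. P x \<Longrightarrow> x \<le> u) \<Longrightarrow> s \<le> u"
    using definable_sup[OF K P t0 M] by blast
  have "s \<le> s - d"
  proof (rule s(2))
    fix x assume "P x"
    then have "x + d \<le> s" using step s(1) by blast
    then show "x \<le> s - d" by (simp add: le_diff_eq)
  qed
  with d show False by simp
qed

text \<open>
  Over the reals these are the finite sets. The definition is first order, so that being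
  pseudo-finite is a definable property in definable families (\<open>pseudofinite_dpred\<close>) and can be
  proved by the Archimedean principle above.
\<close>

definition pseudofinite :: "('a::linordered_field \<Rightarrow> bool) \<Rightarrow> bool" where
  "pseudofinite Y \<longleftrightarrow> (\<exists>M. \<forall>y. Y y \<longrightarrow> \<bar>y\<bar> \<le> M) \<and> (\<exists>d>0. \<forall>y z. Y y \<and> Y z \<and> y \<noteq> z \<longrightarrow> d \<le> \<bar>y - z\<bar>)"

lemma pseudofinite_subset: "pseudofinite Y \<Longrightarrow> (\<And>y. Z y \<Longrightarrow> Y y) \<Longrightarrow> pseudofinite Z"
  unfolding pseudofinite_def by meson

lemma pseudofinite_dpred:
  assumes "dpred K (\<lambda>e. R (e 0) (e 1))" "dfun K t"
  shows "dpred K (\<lambda>e. pseudofinite (R (t e)))"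
proof -
  have R: "dpred K (\<lambda>e. R (s e) (t e))" if "dfun K s" "dfun K t" for s t
    by (rule dpred_subst2[OF assms(1) that])
  show ?thesis
    by (rule dpred_subst1[of K "\<lambda>x. pseudofinite (R x)", OF _ assms(2)])
       (unfold pseudofinite_def, intro def_intros R)
qed

lemma pseudofinite_at_most_one:
  assumes "\<And>y z. Y y \<Longrightarrow> Y z \<Longrightarrow> y = z"
  shows "pseudofinite Y"
proof (cases "\<exists>y. Y y")
  case True
  then obtain y where "Y y" by blast
  then have "\<And>z. Y z \<Longrightarrow> z = y" using assms by blast
  then show ?thesis unfolding pseudofinite_def
    by (intro conjI exI[of _ "\<bar>y\<bar>"] exI[of _ 1]) auto
next
  case False
  then show ?thesis unfolding pseudofinite_def by (auto intro: exI[of _ 1])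
qed

lemma pseudofinite_insert:
  assumes "pseudofinite Y"
  shows "pseudofinite (\<lambda>y. Y y \<or> y = a)"
proof -
  obtain M d where M: "\<And>y. Y y \<Longrightarrow> \<bar>y\<bar> \<le> M" and d: "d > 0"
    "\<And>y z. Y y \<Longrightarrow> Y z \<Longrightarrow> y \<noteq> z \<Longrightarrow> d \<le> \<bar>y - z\<bar>"
    using assms unfolding pseudofinite_def by blast
  \<comment> \<open>At most one element other than \<open>a\<close> is closer to \<open>a\<close> than half the separation of \<open>Y\<close>.\<close>
  obtain r where r: "r > 0" "\<And>y. Y y \<Longrightarrow> y \<noteq> a \<Longrightarrow> r \<le> \<bar>y - a\<bar>"
  proof (cases "\<exists>y. Y y \<and> y \<noteq> a \<and> \<bar>y - a\<bar> < d / 2")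
    case True
    then obtain y where y: "Y y" "y \<noteq> a" "\<bar>y - a\<bar> < d / 2" by blast
    show thesis
    proof (rule that[of "\<bar>y - a\<bar>"])
      show "\<bar>y - a\<bar> > 0" using y by simp
      fix z assume z: "Y z" "z \<noteq> a"
      show "\<bar>y - a\<bar> \<le> \<bar>z - a\<bar>"
      proof (rule ccontr)
        assume c: "\<not> ?thesis"
        then have "d \<le> \<bar>y - z\<bar>" using d(2)[OF y(1) z(1)] by auto
        also have "\<dots> \<le> \<bar>y - a\<bar> + \<bar>z - a\<bar>" by arith
        finally show False using c y(3) by (simp add: field_simps)
      qed
    qed
  next
    case False
    then show thesis using d(1) by (intro that[of "d / 2"]) (auto simp: not_less)
  qed
  show ?thesis unfolding pseudofinite_def
  proof (intro conjI)
    show "\<exists>M. \<forall>y. Y y \<or> y = a \<longrightarrow> \<bar>y\<bar> \<le> M"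
      using M by (intro exI[of _ "max M \<bar>a\<bar>"]) (auto simp: le_max_iff_disj)
    show "\<exists>d>0. \<forall>y z. (Y y \<or> y = a) \<and> (Y z \<or> z = a) \<and> y \<noteq> z \<longrightarrow> d \<le> \<bar>y - z\<bar>"
      using d r by (intro exI[of _ "min d r"]) (auto simp: min_le_iff_disj abs_minus_commute)
  qed
qed

text \<open>
  Sets are scanned from left to right in steps shorter than their separation, so that every step
  meets at most one new element.
\<close>

lemma pseudofinite_scan:
  assumes K: "definably_complete K"
    and Y: "pseudofinite Y"
    and P: "dpred K (\<lambda>e. P (e 0))"
    and empty: "\<And>t. (\<And>y. Y y \<Longrightarrow> t < y) \<Longrightarrow> P t"
    and same: "\<And>t t'. P t \<Longrightarrow> t < t' \<Longrightarrow> (\<And>y. Y y \<Longrightarrow> \<not> (t < y \<and> y \<le> t')) \<Longrightarrow> P t'"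
    and new: "\<And>t t' y. P t \<Longrightarrow> t < t' \<Longrightarrow> Y y \<Longrightarrow> t < y \<Longrightarrow> y \<le> t' \<Longrightarrow>
      (\<And>z. Y z \<Longrightarrow> t < z \<Longrightarrow> z \<le> t' \<Longrightarrow> z = y) \<Longrightarrow> P t'"
  obtains t where "P t" "\<And>y. Y y \<Longrightarrow> y \<le> t"
proof -
  obtain M d where M: "\<And>y. Y y \<Longrightarrow> \<bar>y\<bar> \<le> M" and d: "d > 0"
    "\<And>y z. Y y \<Longrightarrow> Y z \<Longrightarrow> y \<noteq> z \<Longrightarrow> d \<le> \<bar>y - z\<bar>"
    using Y unfolding pseudofinite_def by blast
  have "\<exists>t\<ge>M. P t"
  proof (rule definable_archimedean[OF K P])
    show "P (- M - 1)"
    proof (rule empty)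
      fix y assume "Y y"
      from M[OF this] show "- M - 1 < y" by arith
    qed
    show "d / 2 > 0" using d(1) by simp
    fix t assume t: "P t"
    show "P (t + d / 2)"
    proof (cases "\<exists>y. Y y \<and> t < y \<and> y \<le> t + d / 2")
      case True
      then obtain y where y: "Y y" "t < y" "y \<le> t + d / 2" by blast
      show ?thesis
      proof (rule new[OF t _ y])
        show "t < t + d / 2" using d(1) by simp
        fix z assume z: "Y z" "t < z" "z \<le> t + d / 2"
        have "z - y \<le> d / 2" "y - z \<le> d / 2" using y z by (simp_all add: algebra_simps)
        then have "\<bar>z - y\<bar> \<le> d / 2" by (simp only: abs_le_iff minus_diff_eq)
        also have "\<dots> < d" using d(1) by simp
        finally show "z = y" using d(2)[OF z(1) y(1)] by (metis not_le)
      qed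
    next
      case False
      then show ?thesis using d(1) by (intro same[OF t]) auto
    qed
  qed
  then obtain t where "t \<ge> M" "P t" by blast
  moreover have "y \<le> t" if "Y y" for y using M[OF that] \<open>t \<ge> M\<close> by arith
  ultimately show thesis using that by blast
qed

text \<open>
  The points of one set are added to the other one at a time, from left to right.
\<close>

lemma pseudofinite_union:
  assumes K: "definably_complete K"
    and Y: "dpred K (\<lambda>e. Y (e 0))" "pseudofinite Y" and Z: "dpred K (\<lambda>e. Z (e 0))" "pseudofinite Z"
  shows "pseudofinite (\<lambda>y. Y y \<or> Z y)"
proof -
  have Yd: "dpred K (\<lambda>e. Y (s e))" if "dfun K s" for s by (rule dpred_subst1[OF Y(1) that])
  have Zd: "dpred K (\<lambda>e. Z (s e))" if "dfun K s" for s by (rule dpred_subst1[OF Z(1) that])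
  have "dpred K (\<lambda>e. pseudofinite (\<lambda>y. Y y \<and> y \<le> e 0 \<or> Z y))"
    by (rule pseudofinite_dpred[of K "\<lambda>t y. Y y \<and> y \<le> t \<or> Z y"]) (intro def_intros Yd Zd)+
  then obtain t where t: "pseudofinite (\<lambda>y. Y y \<and> y \<le> t \<or> Z y)" "\<And>y. Y y \<Longrightarrow> y \<le> t"
  proof (rule pseudofinite_scan[OF K Y(2)])
    fix t assume *: "\<And>y. Y y \<Longrightarrow> t < y"
    show "pseudofinite (\<lambda>y. Y y \<and> y \<le> t \<or> Z y)"
      by (rule pseudofinite_subset[OF Z(2)]) (use * in \<open>blast dest: leD\<close>)
  next
    fix t t' assume *: "pseudofinite (\<lambda>y. Y y \<and> y \<le> t \<or> Z y)" "\<And>y. Y y \<Longrightarrow> \<not> (t < y \<and> y \<le> t')"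
    show "pseudofinite (\<lambda>y. Y y \<and> y \<le> t' \<or> Z y)"
      by (rule pseudofinite_subset[OF *(1)]) (use *(2) not_le in blast)
  next
    fix t t' y assume *: "pseudofinite (\<lambda>y. Y y \<and> y \<le> t \<or> Z y)"
      "\<And>z. Y z \<Longrightarrow> t < z \<Longrightarrow> z \<le> t' \<Longrightarrow> z = y"
    show "pseudofinite (\<lambda>y. Y y \<and> y \<le> t' \<or> Z y)"
      by (rule pseudofinite_subset[OF pseudofinite_insert[OF *(1), of y]]) (use *(2) not_le in blast)
  qed blast
  show ?thesis by (rule pseudofinite_subset[OF t(1)]) (use t(2) in auto)
qed

text \<open>
  Pseudo-finite sets are well ordered, as far as definable subsets can tell, by every definable
  linear order and not just by the order of \<open>K\<close>: scanning the set from left to right, the least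
  element seen so far is updated at each new point. The second assumption on \<open>lt\<close> is the transitivity
  of its negated converse, which is the reflexive version of a linear order.
\<close>

lemma pseudofinite_least:
  assumes K: "definably_complete K"
    and B: "dpred K (\<lambda>e. B (e 0))" "pseudofinite B" "\<exists>x. B x"
    and lt: "dpred K (\<lambda>e. lt (e 0) (e 1))"
    and asym: "\<And>x y. B x \<Longrightarrow> B y \<Longrightarrow> lt x y \<Longrightarrow> \<not> lt y x"
    and trans: "\<And>x y z. B x \<Longrightarrow> B y \<Longrightarrow> B z \<Longrightarrow> \<not> lt y x \<Longrightarrow> \<not> lt z y \<Longrightarrow> \<not> lt z x"
  obtains m where "B m" "\<And>x. B x \<Longrightarrow> \<not> lt x m"
proof -
  have Bd: "dpred K (\<lambda>e. B (s e))" if "dfun K s" for s by (rule dpred_subst1[OF B(1) that])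
  have ld: "dpred K (\<lambda>e. lt (s e) (t e))" if "dfun K s" "dfun K t" for s t
    by (rule dpred_subst2[OF lt that])
  define P where "P t \<longleftrightarrow> (\<forall>x. B x \<longrightarrow> t < x) \<or> (\<exists>m. B m \<and> m \<le> t \<and> (\<forall>x. B x \<and> x \<le> t \<longrightarrow> \<not> lt x m))" for t
  have "dpred K (\<lambda>e. P (e 0))"
    unfolding P_def by (intro def_intros Bd ld)
  then obtain t where t: "P t" "\<And>y. B y \<Longrightarrow> y \<le> t"
  proof (rule pseudofinite_scan[OF K B(2)])
    fix t assume "\<And>y. B y \<Longrightarrow> t < y"
    then show "P t" unfolding P_def by blast
  next
    fix t t' assume *: "P t" "t < t'" and no: "\<And>y. B y \<Longrightarrow> \<not> (t < y \<and> y \<le> t')"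
    have "y \<le> t' \<longleftrightarrow> y \<le> t" if "B y" for y using no[OF that] *(2) by (auto simp: not_less)
    then show "P t'" using *(1) unfolding P_def by (metis not_less)
  next
    fix t t' y
    assume *: "P t" "t < t'" "B y" "t < y" "y \<le> t'"
      and uniq: "\<And>z. B z \<Longrightarrow> t < z \<Longrightarrow> z \<le> t' \<Longrightarrow> z = y"
    have new: "z \<le> t \<or> z = y" if "B z" "z \<le> t'" for z using uniq[OF that(1)] that by (meson not_le)
    from *(1) consider "\<forall>x. B x \<longrightarrow> t < x"
      | m where "B m" "m \<le> t" "\<And>x. B x \<Longrightarrow> x \<le> t \<Longrightarrow> \<not> lt x m" unfolding P_def by blast
    then show "P t'"
    proof cases
      case 1
      then have "\<forall>x. B x \<and> x \<le> t' \<longrightarrow> \<not> lt x y" using new asym[OF *(3) *(3)] by (metis not_le)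
      then show ?thesis unfolding P_def using * by blast
    next
      case 2
      show ?thesis
      proof (cases "lt y m")
        case True
        have "\<not> lt x y" if "B x" "x \<le> t'" for x
          using new[OF that]
        proof
          assume "x \<le> t"
          then have "\<not> lt x m" using 2(3) that(1) by blast
          moreover have "\<not> lt m y" using asym[OF *(3) 2(1) True] .
          ultimately show ?thesis using trans[OF *(3) 2(1) that(1)] by blast
        qed (use asym[OF *(3) *(3)] in blast)
        then show ?thesis unfolding P_def using * by blast
      next
        case False
        then have "\<forall>x. B x \<and> x \<le> t' \<longrightarrow> \<not> lt x m" using new 2(3) by blast
        moreover have "m \<le> t'" using 2(2) *(2) by simp
        ultimately show ?thesis unfolding P_def using 2(1) by blast
      qed
    qed
  qed blast
  obtain b where "B b" using B(3) by blast
  then have "\<not> (\<forall>x. B x \<longrightarrow> t < x)" using t(2) by (meson not_le)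
  then obtain m where "B m" "\<forall>x. B x \<and> x \<le> t \<longrightarrow> \<not> lt x m" using t(1) unfolding P_def by blast
  then show thesis using t(2) that by blast
qed

text \<open>
  The values of a definable function on a bounded and uniformly separated subset of \<open>K\<^sup>n\<close> form a
  pseudo-finite set. An environment in \<open>G\<close> has a value as entry \<open>0\<close> and the argument as entries
  \<open>1, \<dots>, n\<close>. Letting \<open>G\<close> be any definable predicate with separated arguments for distinct values makes
  the induction on \<open>n\<close> immediate: in a slice where the last coordinate varies by less than the
  separation, the remaining coordinates still separate distinct values, so no projection or inverse
  function has to be formed. The slices are put together by \<open>pseudofinite_union\<close> along the last coordinate.
\<close>

lemma pseudofinite_image:
  assumes K: "definably_complete K"
    and G: "dpred K G" and d: "d > 0"
    and bd: "\<And>e i. G e \<Longrightarrow> 1 \<le> i \<Longrightarrow> i \<le> n \<Longrightarrow> \<bar>e i\<bar> \<le> M"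
    and sep: "\<And>e e'. G e \<Longrightarrow> G e' \<Longrightarrow> e 0 \<noteq> e' 0 \<Longrightarrow> \<exists>i. 1 \<le> i \<and> i \<le> n \<and> d \<le> \<bar>e i - e' i\<bar>"
  shows "pseudofinite (\<lambda>y. \<exists>e. G e \<and> e 0 = y)"
  using G bd sep
proof (induction n arbitrary: G)
  case 0
  show ?case by (rule pseudofinite_at_most_one) (use 0(3) in force)
next
  case (Suc n)
  define R where "R t y \<longleftrightarrow> (\<exists>e. G e \<and> e (Suc n) \<le> t \<and> e 0 = y)" for t y
  \<comment> \<open>Entries \<open>0\<close> and \<open>1\<close> hold the threshold and the value, the arguments are shifted by one.\<close>
  have "dpred K (\<lambda>e. \<exists>e'. (\<forall>i<2. e' i = e i) \<and>
      G (\<lambda>i. e' (if i = 0 then 1 else i + 1)) \<and> e' (n + 2) \<le> e' 0)"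
    by (intro dpred_ex_env def_intros dpred_rename[OF Suc.prems(1)])
  moreover have "R (e 0) (e 1) \<longleftrightarrow> (\<exists>e'. (\<forall>i<2. e' i = e i) \<and>
      G (\<lambda>i. e' (if i = 0 then 1 else i + 1)) \<and> e' (n + 2) \<le> e' 0)" (is "_ \<longleftrightarrow> ?r") for e
  proof
    assume "R (e 0) (e 1)"
    then obtain x where x: "G x" "x (Suc n) \<le> e 0" "x 0 = e 1" unfolding R_def by blast
    let ?e' = "\<lambda>i. if i = 0 then e 0 else if i = 1 then x 0 else x (i - 1)"
    have "(\<lambda>i. ?e' (if i = 0 then 1 else i + 1)) = x" by auto
    then show ?r using x by (intro exI[of _ ?e']) (auto simp: less_2_cases_iff)
  next
    assume ?r
    then obtain e' where "\<forall>i<2. e' i = e i" "G (\<lambda>i. e' (if i = 0 then 1 else i + 1))" "e' (n + 2) \<le> e' 0"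
      by blast
    then show "R (e 0) (e 1)" unfolding R_def
      by (intro exI[of _ "\<lambda>i. e' (if i = 0 then 1 else i + 1)"]) auto
  qed
  ultimately have R: "dpred K (\<lambda>e. R (e 0) (e 1))" by simp
  have "\<exists>t\<ge>M. pseudofinite (R t)"
  proof (rule definable_archimedean[OF K])
    show "dpred K (\<lambda>e. pseudofinite (R (e 0)))" by (rule pseudofinite_dpred[OF R dfun_var])
    have "\<not> R (- M - 1) y" for y
    proof
      assume "R (- M - 1) y"
      then obtain e where "G e" "e (Suc n) \<le> - M - 1" unfolding R_def by blast
      with Suc.prems(2)[of e "Suc n"] show False by (simp add: abs_le_iff)
    qed
    then show "pseudofinite (R (- M - 1))" by (intro pseudofinite_at_most_one) blast
    show "d / 2 > 0" using d by simp
    fix t assume t: "pseudofinite (R t)"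
    \<comment> \<open>Two points of this slice are separated already in the first \<open>n\<close> coordinates.\<close>
    define H where "H e \<longleftrightarrow> G e \<and> t < e (Suc n) \<and> e (Suc n) \<le> t + d / 2" for e
    have H: "dpred K H" unfolding H_def by (intro def_intros Suc.prems(1))
    have "pseudofinite (\<lambda>y. \<exists>e. H e \<and> e 0 = y)"
    proof (rule Suc.IH[OF H])
      show "\<bar>e i\<bar> \<le> M" if "H e" "1 \<le> i" "i \<le> n" for e i
        using Suc.prems(2)[of e i] that unfolding H_def by simp
      fix e e' assume *: "H e" "H e'" "e 0 \<noteq> e' 0"
      then obtain i where i: "1 \<le> i" "i \<le> Suc n" "d \<le> \<bar>e i - e' i\<bar>"
        using Suc.prems(3)[of e e'] unfolding H_def by blast
      have "\<bar>e (Suc n) - e' (Suc n)\<bar> \<le> d / 2"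
        using * unfolding H_def abs_le_iff minus_diff_eq by (simp add: algebra_simps)
      also have "\<dots> < d" using d by simp
      finally have "i \<noteq> Suc n" using i(3) by auto
      then show "\<exists>i. 1 \<le> i \<and> i \<le> n \<and> d \<le> \<bar>e i - e' i\<bar>" using i by (intro exI[of _ i]) auto
    qed
    moreover have "dpred K (\<lambda>e. \<exists>e'. H e' \<and> e' 0 = e 0)"
      using dpred_ex_env[OF H, of 1] by (simp add: conj_commute)
    moreover have "dpred K (\<lambda>e. R t (e 0))"
      by (rule dpred_subst2[OF R]) (intro def_intros)+
    ultimately have "pseudofinite (\<lambda>y. R t y \<or> (\<exists>e. H e \<and> e 0 = y))"
      using t by (intro pseudofinite_union[OF K]) auto
    then show "pseudofinite (R (t + d / 2))"
    proof (rule pseudofinite_subset)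
      fix y assume "R (t + d / 2) y"
      then obtain e where "G e" "e (Suc n) \<le> t + d / 2" "e 0 = y" unfolding R_def by blast
      then show "R t y \<or> (\<exists>e. H e \<and> e 0 = y)"
        unfolding R_def H_def by (cases "e (Suc n) \<le> t") (auto simp: not_le)
    qed
  qed
  then obtain t where t: "t \<ge> M" "pseudofinite (R t)" by blast
  show ?case
  proof (rule pseudofinite_subset[OF t(2)])
    fix y assume "\<exists>e. G e \<and> e 0 = y"
    then obtain e where e: "G e" "e 0 = y" by blast
    with Suc.prems(2)[of e "Suc n"] t(1) have "e (Suc n) \<le> t" by (simp add: abs_le_iff)
    with e show "R t y" unfolding R_def by blast
  qed
qed

section \<open>Exhausting a somewhere dense image\<close>

text \<open>
  The data to which a counterexample to the first alternative is reduced: a dense subset of an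
  interval \<open>(a, b)\<close> that is the union of an increasing definable family of pseudo-finite sets. The
  parameter \<open>t\<close> of \<open>A\<close> can be read as a time, and the points of the dense set as being born in the
  course of time.
\<close>

locale exhausted_dense_set =
  fixes K :: "('f, 'r, 'a::linordered_field) expansion" and A :: "'a \<Rightarrow> 'a \<Rightarrow> bool" and a b :: 'a
  assumes complete: "definably_complete K"
    and A_definable: "dpred K (\<lambda>e. A (e 0) (e 1))"
    and A_mono: "A t x \<Longrightarrow> t \<le> t' \<Longrightarrow> A t' x"
    and A_pseudofinite: "pseudofinite (A t)"
    and A_between: "A t x \<Longrightarrow> a < x \<and> x < b"
    and a_less_b: "a < b"
    and A_dense: "a \<le> u \<Longrightarrow> u < v \<Longrightarrow> v \<le> b \<Longrightarrow> \<exists>t x. A t x \<and> u < x \<and> x < v"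

lemma open_contains_symmetric_interval:
  fixes S :: "'a::{linordered_field, linorder_topology} set"
  assumes "open S" "x \<in> S"
  obtains r where "r > 0" "{x - r<..<x + r} \<subseteq> S"
proof -
  obtain b where b: "b > x" "{x..<b} \<subseteq> S"
    using open_right[OF assms, of "x + 1"] by auto
  obtain c where c: "c < x" "{c<..x} \<subseteq> S"
    using open_left[OF assms, of "x - 1"] by auto
  show thesis
  proof (rule that[of "min (b - x) (x - c)"])
    show "min (b - x) (x - c) > 0" using b c by simp
    show "{x - min (b - x) (x - c)<..<x + min (b - x) (x - c)} \<subseteq> S"
    proof
      fix y assume "y \<in> {x - min (b - x) (x - c)<..<x + min (b - x) (x - c)}"
      then have y: "x - min (b - x) (x - c) < y" "y < x + min (b - x) (x - c)" by auto
      have "min (b - x) (x - c) \<le> b - x" "min (b - x) (x - c) \<le> x - c" by auto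
      with y have "c < y" "y < b" by (auto simp: algebra_simps)
      then show "y \<in> S" using b(2) c(2) by (cases "x \<le> y") auto
    qed
  qed
qed

lemma discrete_in_power_isolated:
  fixes D :: "(nat \<Rightarrow> 'a::{linordered_field, linorder_topology}) set"
  assumes "discrete_in_power n D" "x \<in> D"
  obtains r where "r > 0" "\<And>y. y \<in> D \<Longrightarrow> (\<And>i. i < n \<Longrightarrow> \<bar>x i - y i\<bar> < r) \<Longrightarrow> y = x"
proof -
  have D: "D \<subseteq> power_set n" "subtopology (power_top n) D = discrete_topology D"
    using assms(1) unfolding discrete_in_power_def by auto
  have "openin (subtopology (power_top n) D) {x}" using assms(2) D(2) by simp
  then obtain T where T: "openin (power_top n) T" "{x} = T \<inter> D"
    unfolding openin_subtopology by blast
  then have "x \<in> T" by blast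
  then obtain U where U: "\<forall>i\<in>{..<n}. openin euclidean (U i)" "x \<in> Pi\<^sub>E {..<n} U" "Pi\<^sub>E {..<n} U \<subseteq> T"
    using T(1) unfolding power_top_def openin_product_topology_alt by blast
  have "\<forall>i\<in>{..<n}. \<exists>r>0. {x i - r<..<x i + r} \<subseteq> U i"
  proof
    fix i assume i: "i \<in> {..<n}"
    then have "open (U i)" "x i \<in> U i" using U(1,2) by auto
    then show "\<exists>r>0. {x i - r<..<x i + r} \<subseteq> U i"
      by (rule open_contains_symmetric_interval) blast
  qed
  from bchoice[OF this] obtain r where r: "\<forall>i\<in>{..<n}. r i > 0 \<and> {x i - r i<..<x i + r i} \<subseteq> U i" ..
  show thesis
  proof (rule that[of "Min (insert 1 (r ` {..<n}))"])
    show "Min (insert 1 (r ` {..<n})) > 0" using r by simp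
    fix y assume y: "y \<in> D" "\<And>i. i < n \<Longrightarrow> \<bar>x i - y i\<bar> < Min (insert 1 (r ` {..<n}))"
    have "y i \<in> U i" if "i < n" for i
    proof -
      have "\<bar>x i - y i\<bar> < r i" using y(2)[OF that] that by simp
      then have "x i - r i < y i" "y i < x i + r i" by (auto simp: abs_less_iff algebra_simps)
      then have "y i \<in> {x i - r i<..<x i + r i}" by simp
      then show ?thesis using r that by blast
    qed
    moreover have "y \<in> power_set n" using y(1) D(1) by blast
    ultimately have "y \<in> Pi\<^sub>E {..<n} U" unfolding power_set_def by (auto simp: PiE_iff)
    then have "y \<in> T \<inter> D" using U(3) y(1) by blast
    then show "y = x" using T(2) by blast
  qed
qed

lemma not_nowhere_dense_interval:
  fixes S :: "'a::{linordered_field, linorder_topology} set"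
  assumes "\<not> nowhere_dense S"
  obtains a b where "a < b" "\<And>u v. a \<le> u \<Longrightarrow> u < v \<Longrightarrow> v \<le> b \<Longrightarrow> \<exists>y\<in>S. u < y \<and> y < v"
proof -
  obtain x where x: "x \<in> interior (closure S)" using assms unfolding nowhere_dense_def by blast
  obtain r where r: "r > 0" "{x - r<..<x + r} \<subseteq> interior (closure S)"
    using open_contains_symmetric_interval[OF open_interior x] by blast
  have sub: "{x - r<..<x + r} \<subseteq> closure S" using r(2) interior_subset by blast
  show thesis
  proof (rule that)
    show "x - r < x + r" using r(1) by simp
    fix u v assume uv: "x - r \<le> u" "u < v" "v \<le> x + r"
    obtain m where m: "u < m" "m < v" using dense[OF uv(2)] by blast
    then have "m \<in> {u<..<v} \<inter> closure S" using sub uv by auto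
    then have "{u<..<v} \<inter> S \<noteq> {}"
      using open_Int_closure_eq_empty[OF open_greaterThanLessThan[of u v], of S] by blast
    then show "\<exists>y\<in>S. u < y \<and> y < v" by auto
  qed
qed

text \<open>
  At time \<open>t\<close> only those points of \<open>D\<close> are used that have norm at most \<open>t\<close> and distance at least
  \<open>1 / t\<close> from the rest of \<open>D\<close>. They form a bounded and uniformly separated set, so its image is
  pseudo-finite by \<open>pseudofinite_image\<close>, and by discreteness every point of \<open>D\<close> occurs at some time.
\<close>

lemma dense_image_exhaustion:
  fixes K :: "('f, 'r, 'a::{linordered_field, linorder_topology}) expansion"
  assumes K: "definably_complete K"
    and D: "definable K n D" "discrete_in_power n D"
    and f: "definable_fun K n f"
    and nd: "\<not> nowhere_dense (f ` D)"
  obtains A a b where "exhausted_dense_set K A a b"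
proof -
  obtain a b where ab: "a < b" and dense: "\<And>u v. a \<le> u \<Longrightarrow> u < v \<Longrightarrow> v \<le> b \<Longrightarrow> \<exists>y\<in>f ` D. u < y \<and> y < v"
    using not_nowhere_dense_interval[OF nd] by blast
  have Dsub: "D \<subseteq> power_set n" using D(2) unfolding discrete_in_power_def by blast
  have neq: "z \<noteq> x \<longleftrightarrow> \<not> (\<forall>i<n. z i = x i)" if "z \<in> power_set n" "x \<in> power_set n" for x z :: "nat \<Rightarrow> 'a"
    using PiE_ext[OF that[unfolded power_set_def]] by blast
  define sep where "sep t x z \<longleftrightarrow> (\<exists>i<n. 1 \<le> t * \<bar>x i - z i\<bar>)" for t and x z :: "nat \<Rightarrow> 'a"
  define Iso where "Iso t x \<longleftrightarrow> 0 < t \<and> x \<in> D \<and> (\<forall>i<n. \<bar>x i\<bar> \<le> t) \<and> (\<forall>z\<in>D. z \<noteq> x \<longrightarrow> sep t x z)" for t x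
  let ?x = "\<lambda>e. restrict (\<lambda>i. e (Suc i)) {..<n}"
  have Dd: "dpred K (\<lambda>e. restrict (\<lambda>i. e (\<sigma> i)) {..<n} \<in> D)" for \<sigma>
    by (rule dpred_rename[OF definable_dpred[OF D(1)]])
  \<comment> \<open>Entry \<open>0\<close> is the time, followed by the tuple \<open>x\<close> and, under the quantifier, by the tuple \<open>z\<close>.\<close>
  have "dpred K (\<lambda>e'. \<forall>i<n. e' (Suc n + i) = e' (Suc i))"
    by (intro dpred_all_less dpred_eq dfun_var)
  moreover have "dpred K (\<lambda>e'. \<forall>i<n. \<not> 1 \<le> e' 0 * \<bar>e' (Suc i) - e' (Suc n + i)\<bar>)"
    by (intro dpred_not dpred_all_less dpred_le dfun_times dfun_abs dfun_minus dfun_var dfun_const)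
  moreover have "dpred K (\<lambda>e. \<forall>i<n. \<bar>e (Suc i)\<bar> \<le> e 0)"
    by (intro dpred_all_less dpred_le dfun_abs dfun_var)
  moreover have "dpred K (\<lambda>e. 0 < e 0)" by (intro dpred_less dfun_const dfun_var)
  ultimately have "dpred K (\<lambda>e. 0 < e 0 \<and> ?x e \<in> D \<and> (\<forall>i<n. \<bar>e (Suc i)\<bar> \<le> e 0) \<and>
      \<not> (\<exists>e'. (\<forall>i<Suc n. e' i = e i) \<and> restrict (\<lambda>i. e' (Suc n + i)) {..<n} \<in> D \<and>
        \<not> (\<forall>i<n. e' (Suc n + i) = e' (Suc i)) \<and>
        (\<forall>i<n. \<not> 1 \<le> e' 0 * \<bar>e' (Suc i) - e' (Suc n + i)\<bar>)))"
    by (intro dpred_ex_env dpred_conj dpred_not Dd)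
  moreover have "Iso (e 0) (?x e) \<longleftrightarrow> 0 < e 0 \<and> ?x e \<in> D \<and> (\<forall>i<n. \<bar>e (Suc i)\<bar> \<le> e 0) \<and>
      \<not> (\<exists>e'. (\<forall>i<Suc n. e' i = e i) \<and> restrict (\<lambda>i. e' (Suc n + i)) {..<n} \<in> D \<and>
        \<not> (\<forall>i<n. e' (Suc n + i) = e' (Suc i)) \<and>
        (\<forall>i<n. \<not> 1 \<le> e' 0 * \<bar>e' (Suc i) - e' (Suc n + i)\<bar>))" for e
  proof -
    have "(\<exists>z\<in>D. z \<noteq> ?x e \<and> \<not> sep (e 0) (?x e) z) \<longleftrightarrow>
      (\<exists>e'. (\<forall>i<Suc n. e' i = e i) \<and> restrict (\<lambda>i. e' (Suc n + i)) {..<n} \<in> D \<and>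
        \<not> (\<forall>i<n. e' (Suc n + i) = e' (Suc i)) \<and>
        (\<forall>i<n. \<not> 1 \<le> e' 0 * \<bar>e' (Suc i) - e' (Suc n + i)\<bar>))" (is "?l \<longleftrightarrow> ?r")
    proof
      assume ?l
      then obtain z where z: "z \<in> D" "z \<noteq> ?x e" "\<not> sep (e 0) (?x e) z" by blast
      have zp: "z \<in> power_set n" using z(1) Dsub by blast
      let ?e' = "\<lambda>i. if i < Suc n then e i else z (i - Suc n)"
      have "restrict (\<lambda>i. ?e' (Suc n + i)) {..<n} = z"
        using PiE_restrict[OF zp[unfolded power_set_def]] by simp
      moreover have "\<not> (\<forall>i<n. z i = ?x e i)"
        using z(2) neq[OF zp, of "?x e"] by (simp add: power_set_def)
      moreover have "\<forall>i<n. \<not> 1 \<le> e 0 * \<bar>e (Suc i) - z i\<bar>"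
        using z(3) unfolding sep_def by auto
      ultimately show ?r using z(1) by (intro exI[of _ ?e']) auto
    next
      assume ?r
      then obtain e' where e': "\<forall>i<Suc n. e' i = e i" "restrict (\<lambda>i. e' (Suc n + i)) {..<n} \<in> D"
        "\<not> (\<forall>i<n. e' (Suc n + i) = e' (Suc i))"
        "\<forall>i<n. \<not> 1 \<le> e' 0 * \<bar>e' (Suc i) - e' (Suc n + i)\<bar>" by blast
      let ?z = "restrict (\<lambda>i. e' (Suc n + i)) {..<n}"
      have e: "e' 0 = e 0" "\<And>i. i < n \<Longrightarrow> e' (Suc i) = e (Suc i)" using e'(1) by auto
      have "?z \<noteq> ?x e"
      proof
        assume "?z = ?x e"
        then have "?z i = ?x e i" for i by simp
        then have "\<forall>i<n. e' (Suc n + i) = e' (Suc i)" using e(2) by (metis lessThan_iff restrict_apply')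
        with e'(3) show False by blast
      qed
      moreover have "\<not> sep (e 0) (?x e) ?z"
        using e'(4) e unfolding sep_def by auto
      ultimately show ?l using e'(2) by blast
    qed
    then show ?thesis unfolding Iso_def by auto
  qed
  ultimately have Iso0: "dpred K (\<lambda>e. Iso (e 0) (?x e))" by simp
  have IsoD: "dpred K (\<lambda>e. Iso (e k) (restrict (\<lambda>i. e (\<sigma> i)) {..<n}))" for k \<sigma>
    using dpred_rename[OF Iso0, of "\<lambda>i. case i of 0 \<Rightarrow> k | Suc j \<Rightarrow> \<sigma> j"] by simp
  have fd: "dpred K (\<lambda>e. e k = f (restrict (\<lambda>i. e (\<sigma> i)) {..<n}))" for k \<sigma>
  proof -
    have "dpred K (\<lambda>e. restrict e {..<Suc n} \<in> {x \<in> power_set (Suc n). x n = f (restrict x {..<n})})"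
      using f unfolding definable_fun_def by (rule definable_dpred)
    moreover have "restrict (restrict e {..<Suc n}) {..<n} = restrict e {..<n}" for e :: "nat \<Rightarrow> 'a"
      by (rule ext) (simp add: restrict_def)
    ultimately have *: "dpred K (\<lambda>e. e n = f (restrict e {..<n}))" by (simp add: power_set_def)
    have "restrict (\<lambda>i. e (if i < n then \<sigma> i else k)) {..<n} = restrict (\<lambda>i. e (\<sigma> i)) {..<n}" for e :: "nat \<Rightarrow> 'a"
      by (rule ext) (simp add: restrict_def)
    with dpred_rename[OF *, of "\<lambda>i. if i < n then \<sigma> i else k"] show ?thesis by simp
  qed
  define A where "A t y \<longleftrightarrow> a < y \<and> y < b \<and> (\<exists>x. Iso t x \<and> y = f x)" for t y
  have restr: "restrict x {..<n} = x" if "Iso t x" for t x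
    using that Dsub unfolding Iso_def power_set_def by (metis PiE_restrict subsetD)
  show thesis
  proof (rule that[of A a b], unfold_locales)
    show "definably_complete K" by (rule K)
    have "dpred K (\<lambda>e. a < e 1 \<and> e 1 < b \<and> (\<exists>e'. (\<forall>i<2. e' i = e i) \<and>
        Iso (e' 0) (restrict (\<lambda>i. e' (i + 2)) {..<n}) \<and> e' 1 = f (restrict (\<lambda>i. e' (i + 2)) {..<n})))"
      by (intro dpred_ex_env IsoD fd def_intros)
    moreover have "(\<exists>x. Iso (e 0) x \<and> e 1 = f x) \<longleftrightarrow> (\<exists>e'. (\<forall>i<2. e' i = e i) \<and>
        Iso (e' 0) (restrict (\<lambda>i. e' (i + 2)) {..<n}) \<and> e' 1 = f (restrict (\<lambda>i. e' (i + 2)) {..<n}))"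
      (is "?l \<longleftrightarrow> ?r") for e
    proof
      assume ?l
      then obtain x where x: "Iso (e 0) x" "e 1 = f x" by blast
      let ?e' = "\<lambda>i. if i < 2 then e i else x (i - 2)"
      have "restrict (\<lambda>i. ?e' (i + 2)) {..<n} = x" using restr[OF x(1)] by simp
      then show ?r using x by (intro exI[of _ ?e']) simp
    next
      assume ?r
      then obtain e' where e': "\<forall>i<2. e' i = e i" "Iso (e' 0) (restrict (\<lambda>i. e' (i + 2)) {..<n})"
        "e' 1 = f (restrict (\<lambda>i. e' (i + 2)) {..<n})" by blast
      then have "e' 0 = e 0" "e' 1 = e 1" by simp_all
      with e' show ?l by metis
    qed
    ultimately show "dpred K (\<lambda>e. A (e 0) (e 1))" unfolding A_def by simp
    show "A t' x" if A: "A t x" and tt: "t \<le> t'" for t t' x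
    proof -
      have "sep t' x z" if "sep t x z" for x z
        using that order_trans[OF _ mult_right_mono[OF tt abs_ge_zero]] unfolding sep_def by blast
      then have "Iso t' x" if "Iso t x" for x
        using that tt unfolding Iso_def by (auto intro: order_trans)
      then show ?thesis using A unfolding A_def by blast
    qed
    show "pseudofinite (A t)" for t
    proof (cases "0 < t")
      case True
      have "pseudofinite (\<lambda>y. \<exists>e. (Iso t (?x e) \<and> e 0 = f (?x e)) \<and> e 0 = y)"
      proof (rule pseudofinite_image[OF K, where d = "1 / t" and n = n and M = t])
        have "dpred K (\<lambda>e. \<exists>a. a = t \<and> Iso a (?x e))"
          by (intro dpred_ex def_intros IsoD)
        then show "dpred K (\<lambda>e. Iso t (?x e) \<and> e 0 = f (?x e))"
          by (intro dpred_conj fd) simp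
        show "1 / t > 0" using True by simp
        fix e i assume *: "Iso t (?x e) \<and> e 0 = f (?x e)" "1 \<le> i" "i \<le> n"
        then have "\<forall>i<n. \<bar>?x e i\<bar> \<le> t" unfolding Iso_def by blast
        with *(2,3) show "\<bar>e i\<bar> \<le> t" by (cases i) auto
      next
        fix e e' assume *: "Iso t (?x e) \<and> e 0 = f (?x e)" "Iso t (?x e') \<and> e' 0 = f (?x e')" "e 0 \<noteq> e' 0"
        then have "?x e' \<in> D" "?x e' \<noteq> ?x e" unfolding Iso_def by auto
        then have "sep t (?x e) (?x e')" using *(1) unfolding Iso_def by blast
        then obtain i where i: "i < n" "1 \<le> t * \<bar>e (Suc i) - e' (Suc i)\<bar>" unfolding sep_def by auto
        then have "1 / t \<le> \<bar>e (Suc i) - e' (Suc i)\<bar>" using True by (simp add: divide_le_eq mult.commute)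
        then show "\<exists>i. 1 \<le> i \<and> i \<le> n \<and> 1 / t \<le> \<bar>e i - e' i\<bar>"
          using i(1) by (intro exI[of _ "Suc i"]) auto
      qed
      then show ?thesis
      proof (rule pseudofinite_subset)
        fix y assume "A t y"
        then obtain x where x: "Iso t x" "y = f x" unfolding A_def by blast
        let ?e = "\<lambda>i. case i of 0 \<Rightarrow> y | Suc j \<Rightarrow> x j"
        have "?x ?e = x" using restr[OF x(1)] by simp
        then show "\<exists>e. (Iso t (?x e) \<and> e 0 = f (?x e)) \<and> e 0 = y"
          using x by (intro exI[of _ ?e]) simp
      qed
    next
      case False
      then show ?thesis by (intro pseudofinite_at_most_one) (simp add: A_def Iso_def)
    qed
    show "a < x \<and> x < b" if "A t x" for t x using that unfolding A_def by blast
    show "a < b" by (rule ab)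
    fix u v assume uv: "a \<le> u" "u < v" "v \<le> b"
    then obtain x where x: "x \<in> D" "u < f x" "f x < v" using dense by blast
    obtain r where r: "r > 0" "\<And>y. y \<in> D \<Longrightarrow> (\<And>i. i < n \<Longrightarrow> \<bar>x i - y i\<bar> < r) \<Longrightarrow> y = x"
      using discrete_in_power_isolated[OF D(2) x(1)] by blast
    define t where "t = Max (insert (1 / r) ((\<lambda>i. \<bar>x i\<bar>) ` {..<n}))"
    have t: "1 / r \<le> t" "\<And>i. i < n \<Longrightarrow> \<bar>x i\<bar> \<le> t" unfolding t_def by auto
    then have t0: "0 < t" using r(1) by (meson divide_pos_pos less_le_trans zero_less_one)
    have "sep t x z" if z: "z \<in> D" "z \<noteq> x" for z
    proof -
      obtain i where i: "i < n" "r \<le> \<bar>x i - z i\<bar>" using r(2)[OF z(1)] z(2) by (meson not_le)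
      have "1 = (1 / r) * r" using r(1) by simp
      also have "\<dots> \<le> t * \<bar>x i - z i\<bar>" using t(1) t0 i(2) r(1) by (intro mult_mono) auto
      finally show ?thesis unfolding sep_def using i(1) by blast
    qed
    then have "Iso t x" using t(2) t0 x(1) unfolding Iso_def by blast
    then have "A t (f x)" unfolding A_def using x uv by auto
    then show "\<exists>t x. A t x \<and> u < x \<and> x < v" using x by blast
  qed
qed

section \<open>Coding increasing sequences by points\<close>

context exhausted_dense_set
begin

definition pt :: "'a \<Rightarrow> bool" where
  "pt x \<longleftrightarrow> (\<exists>t. A t x)"

text \<open>
  The order of birth, where points born together are ordered by their position. Every point has
  only pseudo-finitely many predecessors, hence \<open>before\<close> behaves like a well-order of type \<open>\<omega>\<close>
  (\<open>pt_least\<close>).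
\<close>

definition before :: "'a \<Rightarrow> 'a \<Rightarrow> bool" where
  "before x y \<longleftrightarrow> (\<exists>t. A t x \<and> \<not> A t y) \<or> (\<forall>t. A t x \<longleftrightarrow> A t y) \<and> x < y"

lemma A_def_intro: "dfun K s \<Longrightarrow> dfun K t \<Longrightarrow> dpred K (\<lambda>e. A (s e) (t e))"
  by (rule dpred_subst2[OF A_definable])

lemma pt_def_intro: "dfun K s \<Longrightarrow> dpred K (\<lambda>e. pt (s e))"
  by (rule dpred_subst1[of K pt]) (unfold pt_def, intro def_intros A_def_intro)

lemma before_def_intro: "dfun K s \<Longrightarrow> dfun K t \<Longrightarrow> dpred K (\<lambda>e. before (s e) (t e))"
  by (rule dpred_subst2[of K before]) (unfold before_def, intro def_intros A_def_intro)

lemma pt_between: "pt x \<Longrightarrow> a < x \<and> x < b"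
  unfolding pt_def using A_between by blast

lemma A_nested: "(\<forall>t. A t x \<longrightarrow> A t y) \<or> (\<forall>t. A t y \<longrightarrow> A t x)"
proof (rule ccontr)
  assume "\<not> ?thesis"
  then obtain t t' where "A t x" "\<not> A t y" "A t' y" "\<not> A t' x" by blast
  then show False using A_mono linear[of t t'] by blast
qed

lemma before_irrefl: "\<not> before x x"
  unfolding before_def by simp

lemma before_asym: "before x y \<Longrightarrow> \<not> before y x"
  using A_nested[of x y] unfolding before_def by fastforce

lemma before_total: "x \<noteq> y \<Longrightarrow> before x y \<or> before y x"
  unfolding before_def by (metis neqE)

lemma before_trans: "before x y \<Longrightarrow> before y z \<Longrightarrow> before x z"
proof -
  assume xy: "before x y" and yz: "before y z"
  have m: "\<And>t. A t y \<Longrightarrow> A t x" "\<And>t. A t z \<Longrightarrow> A t y"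
    using xy yz A_nested[of x y] A_nested[of y z] unfolding before_def by blast+
  show ?thesis
  proof (cases "\<forall>t. A t x \<longleftrightarrow> A t z")
    case True
    then have "\<forall>t. A t x \<longleftrightarrow> A t y" "\<forall>t. A t y \<longleftrightarrow> A t z" using m by blast+
    then have "x < y" "y < z" using xy yz unfolding before_def by blast+
    then show ?thesis using True unfolding before_def by auto
  next
    case False
    then show ?thesis using m unfolding before_def by blast
  qed
qed

lemma A_initial: "A t y \<Longrightarrow> \<not> before y x \<Longrightarrow> A t x"
  unfolding before_def by blast

lemma pt_least:
  assumes B: "dpred K (\<lambda>e. B (e 0))" "B x" "\<And>x. B x \<Longrightarrow> pt x"
  obtains m where "B m" "\<And>x. B x \<Longrightarrow> \<not> before x m"
proof -
  obtain t where t: "A t x" using B(2,3) unfolding pt_def by blast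
  have Bd: "dpred K (\<lambda>e. B (s e))" if "dfun K s" for s by (rule dpred_subst1[OF B(1) that])
  obtain m where m: "B m \<and> \<not> before x m" "\<And>y. B y \<and> \<not> before x y \<Longrightarrow> \<not> before y m"
  proof (rule pseudofinite_least[OF complete])
    show "dpred K (\<lambda>e. B (e 0) \<and> \<not> before x (e 0))"
      by (intro def_intros Bd before_def_intro)
    show "pseudofinite (\<lambda>y. B y \<and> \<not> before x y)"
      by (rule pseudofinite_subset[OF A_pseudofinite[of t]]) (use A_initial[OF t] in blast)
    show "\<exists>y. B y \<and> \<not> before x y" using B(2) before_irrefl by blast
    show "dpred K (\<lambda>e. before (e 0) (e 1))" by (intro before_def_intro def_intros)
    show "\<not> before y x" if "before x y" for x y using before_asym that .
    show "\<not> before z x" if "\<not> before y x" "\<not> before z y" for x y z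
      using that before_total[of z y] before_trans[of y z x] by metis
  qed blast
  show thesis
  proof (rule that)
    show "B m" using m by blast
    show "\<not> before y m" if "B y" for y
    proof (cases "before x y")
      case True
      then show ?thesis using m(1) before_trans by blast
    qed (use m(2) that in blast)
  qed
qed

text \<open>
  \<open>sep x\<close> is the smallest distance between two points born no later than \<open>x\<close>, cut off so that
  \<open>(x, x + sep x)\<close> stays inside \<open>(a, b)\<close>. As the supremum of the lower bounds
  \<open>sep_bound x\<close> it exists by definable completeness and is a definable function of \<open>x\<close>.
\<close>

definition sep_bound :: "'a \<Rightarrow> 'a \<Rightarrow> bool" where
  "sep_bound x r \<longleftrightarrow> r \<le> b - x \<and>
     (\<forall>y z. pt y \<and> pt z \<and> y \<noteq> z \<and> \<not> before x y \<and> \<not> before x z \<longrightarrow> r \<le> \<bar>y - z\<bar>)"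

definition is_sep :: "'a \<Rightarrow> 'a \<Rightarrow> bool" where
  "is_sep r x \<longleftrightarrow> (\<forall>q. sep_bound x q \<longrightarrow> q \<le> r) \<and> (\<forall>u. (\<forall>q. sep_bound x q \<longrightarrow> q \<le> u) \<longrightarrow> r \<le> u)"

definition sep :: "'a \<Rightarrow> 'a" where
  "sep x = (if \<exists>r. is_sep r x then THE r. is_sep r x else 0)"

lemma sep_bound_def_intro: "dfun K s \<Longrightarrow> dfun K t \<Longrightarrow> dpred K (\<lambda>e. sep_bound (s e) (t e))"
  by (rule dpred_subst2[of K sep_bound])
     (unfold sep_bound_def, intro def_intros pt_def_intro before_def_intro)

lemma is_sep_def_intro: "dfun K s \<Longrightarrow> dfun K t \<Longrightarrow> dpred K (\<lambda>e. is_sep (s e) (t e))"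
  by (rule dpred_subst2[of K is_sep]) (unfold is_sep_def, intro def_intros sep_bound_def_intro)

lemma is_sep_unique: "is_sep r x \<Longrightarrow> is_sep r' x \<Longrightarrow> r = r'"
  unfolding is_sep_def by (meson antisym)

lemma sep_eq: "is_sep r x \<Longrightarrow> sep x = r"
  unfolding sep_def using is_sep_unique by (metis (mono_tags, lifting) the_equality)

lemma sep_def_intro:
  assumes "dfun K s"
  shows "dfun K (\<lambda>e. sep (s e))"
proof (rule dfun_comp1[OF _ assms])
  have "dpred K (\<lambda>e. is_sep (e 0) (e 1) \<or> (\<not> (\<exists>r. is_sep r (e 1))) \<and> e 0 = 0)"
    by (intro def_intros is_sep_def_intro)
  moreover have "r = sep x \<longleftrightarrow> is_sep r x \<or> (\<not> (\<exists>r. is_sep r x)) \<and> r = 0" for r x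
  proof (cases "\<exists>r. is_sep r x")
    case True
    then obtain q where "is_sep q x" by blast
    then show ?thesis using sep_eq is_sep_unique by blast
  qed (auto simp: sep_def)
  ultimately show "dpred K (\<lambda>e. e 0 = sep (e 1))" by simp
qed

lemma
  assumes "pt x"
  shows sep_pos: "sep x > 0"
    and sep_le_end: "sep x \<le> b - x"
    and sep_le: "pt y \<Longrightarrow> pt z \<Longrightarrow> y \<noteq> z \<Longrightarrow> \<not> before x y \<Longrightarrow> \<not> before x z \<Longrightarrow> sep x \<le> \<bar>y - z\<bar>"
proof -
  obtain t where t: "A t x" using assms unfolding pt_def by blast
  obtain d where d: "d > 0" "\<And>y z. A t y \<Longrightarrow> A t z \<Longrightarrow> y \<noteq> z \<Longrightarrow> d \<le> \<bar>y - z\<bar>"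
    using A_pseudofinite[of t] unfolding pseudofinite_def by blast
  have bx: "b - x > 0" using pt_between[OF assms] by simp
  have q: "sep_bound x (min d (b - x))"
    using d(2) A_initial[OF t] unfolding sep_bound_def by (auto simp: min_le_iff_disj)
  obtain r where r: "\<And>q. sep_bound x q \<Longrightarrow> q \<le> r" "\<And>u. (\<And>q. sep_bound x q \<Longrightarrow> q \<le> u) \<Longrightarrow> r \<le> u"
  proof (rule definable_sup[OF complete, of "sep_bound x"])
    show "dpred K (\<lambda>e. sep_bound x (e 0))" by (intro sep_bound_def_intro def_intros)
    show "sep_bound x (min d (b - x))" by (rule q)
    show "q \<le> b - x" if "sep_bound x q" for q using that unfolding sep_bound_def by blast
  qed blast
  have s: "sep x = r" using r by (intro sep_eq) (simp add: is_sep_def)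
  have "min d (b - x) > 0" using d(1) bx by simp
  then show "sep x > 0" unfolding s using r(1)[OF q] by (rule less_le_trans)
  show "sep x \<le> b - x" unfolding s by (rule r(2)) (simp add: sep_bound_def)
  show "sep x \<le> \<bar>y - z\<bar>" if "pt y" "pt z" "y \<noteq> z" "\<not> before x y" "\<not> before x z"
    unfolding s by (rule r(2)) (use that in \<open>auto simp: sep_bound_def\<close>)
qed

text \<open>
  A point \<open>x\<close> codes the sequence of all points \<open>z\<close> born no later than \<open>x\<close> that cover \<open>x\<close>, in the sense
  that \<open>x\<close> lies in the short interval \<open>[z, z + \<sigma> * sep z]\<close>. For \<open>\<sigma> < 1\<close>, being born earlier means lying
  further to the left among the points of a stack. The numbers read off from the stack are the quotients
  \<open>\<sigma> * sep z / (z' - z)\<close> for consecutive elements \<open>z < z'\<close>. They depend on the stack alone, so they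
  do not change when the stack is extended. The condition in \<open>code\<close> guarantees that no element of the
  stack is lost when \<open>x\<close> is replaced by a later point slightly to the right of \<open>x\<close>.
\<close>

definition stack :: "'a \<Rightarrow> 'a \<Rightarrow> 'a \<Rightarrow> bool" where
  "stack \<sigma> x z \<longleftrightarrow> pt z \<and> \<not> before x z \<and> z \<le> x \<and> x \<le> z + \<sigma> * sep z"

definition code :: "'a \<Rightarrow> 'a \<Rightarrow> bool" where
  "code \<sigma> x \<longleftrightarrow> pt x \<and> (\<forall>z. stack \<sigma> x z \<and> z \<noteq> x \<longrightarrow> x + 2 * (\<sigma> * sep x) \<le> z + \<sigma> * sep z)"

definition code_val :: "'a \<Rightarrow> 'a \<Rightarrow> 'a \<Rightarrow> bool" where
  "code_val \<sigma> x v \<longleftrightarrow> (\<exists>z z'. stack \<sigma> x z \<and> stack \<sigma> x z' \<and> z < z' \<and>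
     \<not> (\<exists>y. stack \<sigma> x y \<and> z < y \<and> y < z') \<and> v = \<sigma> * sep z / (z' - z))"

lemma stack_def_intro:
  "dfun K s \<Longrightarrow> dfun K t \<Longrightarrow> dfun K u \<Longrightarrow> dpred K (\<lambda>e. stack (s e) (t e) (u e))"
  by (rule dpred_subst3[of K stack])
     (unfold stack_def, intro def_intros pt_def_intro before_def_intro sep_def_intro)

lemma code_def_intro: "dfun K s \<Longrightarrow> dfun K t \<Longrightarrow> dpred K (\<lambda>e. code (s e) (t e))"
  by (rule dpred_subst2[of K code])
     (unfold code_def, intro def_intros pt_def_intro stack_def_intro sep_def_intro)

lemma code_val_def_intro:
  "dfun K s \<Longrightarrow> dfun K t \<Longrightarrow> dfun K u \<Longrightarrow> dpred K (\<lambda>e. code_val (s e) (t e) (u e))"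
  by (rule dpred_subst3[of K code_val]) (unfold code_val_def, intro def_intros stack_def_intro sep_def_intro)

lemma pt_exists: obtains x where "pt x"
  using A_dense[OF order_refl a_less_b order_refl] unfolding pt_def by blast

text \<open>
  The first point of all has only itself in its stack.
\<close>

lemma code_initial:
  obtains x where "\<And>\<sigma>. code \<sigma> x" "\<And>\<sigma> v. \<not> code_val \<sigma> x v"
proof -
  obtain x0 where "pt x0" by (rule pt_exists)
  moreover have "dpred K (\<lambda>e. pt (e 0))" by (intro pt_def_intro def_intros)
  ultimately obtain x where x: "pt x" "\<And>y. pt y \<Longrightarrow> \<not> before y x"
    using pt_least[of pt] by blast
  have "z = x" if "stack \<sigma> x z" for \<sigma> z
    using that x(2) before_total unfolding stack_def by blast
  then have "code \<sigma> x" "\<not> code_val \<sigma> x v" for \<sigma> v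
    using x(1) unfolding code_def code_val_def by blast+
  then show thesis using that by blast
qed

lemma sep_le_earlier:
  assumes "pt x" "pt y" "before y x"
  shows "sep x \<le> \<bar>x - y\<bar>"
  using sep_le[OF assms(1), of x y] assms before_irrefl before_asym by blast

text \<open>
  The heart of the proof: a code can be extended by one further number from any interval \<open>(p, q)\<close>
  that is not too short in comparison with \<open>\<sigma>\<close>. To append a number between \<open>p\<close> and \<open>q\<close>, a later
  point \<open>y\<close> in the window \<open>(x + h / q, x + h / p)\<close>, where \<open>h = \<sigma> * sep x\<close>, must be added to the
  stack, and no point born between \<open>x\<close> and \<open>y\<close> may cover \<open>y\<close>. Points born early just to the left of
  the window can obstruct this, as can points covered by them, and so on. But along such a chain of
  coverings the quantity \<open>z + 2 * \<sigma> * sep z\<close> never increases: if \<open>z\<close> covers the later point \<open>w\<close>, then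
  \<open>sep w \<le> w - z \<le> \<sigma> * sep z\<close>. For the obstructing points left of the window it is at most
  \<open>x + \<alpha> + 2 * \<sigma> * \<alpha>\<close> with \<open>\<alpha> = h / q\<close>, and this is still inside the window. So one takes the first
  point \<open>y\<close> in the window at which this bound is exceeded; no point born between \<open>x\<close> and \<open>y\<close> covers it.
\<close>

lemma code_extend:
  assumes \<sigma>: "0 < \<sigma>" "\<sigma> \<le> 1 / 2" and x: "code \<sigma> x"
    and pq: "2 \<le> p" "(1 + 2 * \<sigma>) * p < q"
  obtains x' v where "code \<sigma> x'" "p < v" "v < q" "\<And>u. code_val \<sigma> x' u \<longleftrightarrow> code_val \<sigma> x u \<or> u = v"
proof -
  have ptx: "pt x" using x unfolding code_def by blast
  define h where "h = \<sigma> * sep x"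
  have h0: "0 < h" unfolding h_def using \<sigma>(1) sep_pos[OF ptx] by simp
  have hsep: "2 * h \<le> sep x" using mult_right_mono[OF \<sigma>(2), of "sep x"] sep_pos[OF ptx] by (simp add: h_def)
  have p0: "0 < p" using pq(1) by simp
  have "0 < (1 + 2 * \<sigma>) * p" using \<sigma>(1) p0 by (intro mult_pos_pos add_pos_pos) auto
  then have q0: "0 < q" using pq(2) by (rule less_trans)
  define \<alpha> \<beta> where "\<alpha> = h / q" and "\<beta> = h / p"
  have \<alpha>0: "0 < \<alpha>" unfolding \<alpha>_def using h0 q0 by simp
  have \<alpha>\<beta>: "\<alpha> + 2 * \<sigma> * \<alpha> < \<beta>"
  proof -
    have "(1 + 2 * \<sigma>) * p * h < q * h" using pq(2) h0 by simp
    then have "(1 + 2 * \<sigma>) * h / q < h / p" using p0 q0 by (simp add: field_simps)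
    then show ?thesis unfolding \<alpha>_def \<beta>_def by (simp add: algebra_simps add_divide_distrib)
  qed
  have \<beta>h: "2 * \<beta> \<le> h" unfolding \<beta>_def using pq(1) h0 p0 by (simp add: field_simps)
  have \<sigma>\<alpha>: "0 < \<sigma> * \<alpha>" using \<sigma>(1) \<alpha>0 by simp
  \<comment> \<open>No point up to \<open>x\<close> lies within \<open>\<beta>\<close> to the right of \<open>x\<close>.\<close>
  have late: "before x z" if "pt z" "x < z" "z < x + \<beta>" for z
  proof (rule ccontr)
    assume "\<not> before x z"
    then have "sep x \<le> \<bar>x - z\<bar>" using sep_le[OF ptx ptx that(1)] that(2) before_irrefl by auto
    also have "\<dots> < \<beta>" using that(2,3) by simp
    finally show False using hsep \<beta>h h0 by linarith
  qed
  \<comment> \<open>The points of the window that exceed the bound; they exist by density.\<close>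
  define B where "B z \<longleftrightarrow> pt z \<and> x + \<alpha> < z \<and> z < x + \<beta> \<and> x + \<alpha> + 2 * \<sigma> * \<alpha> < z + 2 * (\<sigma> * sep z)" for z
  have Bd: "dpred K (\<lambda>e. B (e 0))"
    unfolding B_def by (intro def_intros pt_def_intro sep_def_intro)
  obtain z0 where z0: "pt z0" "x + \<alpha> + 2 * \<sigma> * \<alpha> < z0" "z0 < x + \<beta>"
  proof -
    have "a \<le> x + \<alpha> + 2 * \<sigma> * \<alpha>" using pt_between[OF ptx] \<alpha>0 \<sigma>\<alpha> by linarith
    moreover have "x + \<beta> \<le> b" using sep_le_end[OF ptx] \<beta>h hsep h0 by linarith
    ultimately show thesis using A_dense[of "x + \<alpha> + 2 * \<sigma> * \<alpha>" "x + \<beta>"] \<alpha>\<beta> that unfolding pt_def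
      by (metis add.assoc add_strict_left_mono)
  qed
  have "0 < 2 * (\<sigma> * sep z0)" using \<sigma>(1) sep_pos[OF z0(1)] by simp
  then have "B z0" unfolding B_def using z0 \<sigma>\<alpha> by (intro conjI; linarith)
  then obtain y where y: "B y" and y_least: "\<And>z. B z \<Longrightarrow> \<not> before z y"
    using pt_least[OF Bd] unfolding B_def by blast
  have pty: "pt y" and xy: "x + \<alpha> < y" "y < x + \<beta>" and reach: "x + \<alpha> + 2 * \<sigma> * \<alpha> < y + 2 * (\<sigma> * sep y)"
    using y unfolding B_def by auto
  have "x < y" using xy \<alpha>0 by linarith
  have bxy: "before x y" using late[OF pty \<open>x < y\<close> xy(2)] .
  have small: "2 * (\<sigma> * sep w) \<le> \<bar>w - z\<bar>" if "pt w" "pt z" "before z w" for w z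
  proof -
    have "2 * \<sigma> * sep w \<le> 1 * sep w" using \<sigma>(2) sep_pos[OF that(1)] by (intro mult_right_mono) auto
    then show ?thesis using sep_le_earlier[OF that] by (simp add: mult.assoc)
  qed
  \<comment> \<open>No point between \<open>x\<close> and \<open>y\<close> covers \<open>y\<close>.\<close>
  have uncovered: "\<not> (z \<le> y \<and> y \<le> z + \<sigma> * sep z)" if z: "pt z" "before x z" "before z y" for z
  proof
    assume c: "z \<le> y \<and> y \<le> z + \<sigma> * sep z"
    have "z \<noteq> y" using z(3) before_irrefl by blast
    then have zy: "z < y" using c by simp
    have "2 * (\<sigma> * sep y) \<le> y - z" using small[OF pty z(1,3)] zy by simp
    then have reach': "x + \<alpha> + 2 * \<sigma> * \<alpha> < z + 2 * (\<sigma> * sep z)" using reach c by linarith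
    have "z \<le> x + \<alpha>"
    proof (rule ccontr)
      assume "\<not> ?thesis"
      then have "B z" unfolding B_def using z(1) zy xy reach' by auto
      then show False using y_least z(3) by blast
    qed
    have szx: "\<sigma> * sep z \<le> \<sigma> * \<bar>z - x\<bar>"
      using sep_le_earlier[OF z(1) ptx z(2)] \<sigma>(1) by simp
    show False
    proof (cases "x < z")
      case True
      have "\<sigma> * \<bar>z - x\<bar> \<le> \<sigma> * \<alpha>" using True \<open>z \<le> x + \<alpha>\<close> \<sigma>(1) by (intro mult_left_mono) auto
      then show False using szx reach' \<open>z \<le> x + \<alpha>\<close> by (simp add: mult.assoc)
    next
      case False
      then have "2 * (\<sigma> * sep z) \<le> x - z" using small[OF z(1) ptx z(2)] by simp
      then show False using reach' \<alpha>0 \<sigma>\<alpha> by (simp add: mult.assoc)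
    qed
  qed
  \<comment> \<open>Points born after \<open>x\<close> do not cover \<open>y\<close>, and for the others covering \<open>x\<close> and covering \<open>y\<close> agree.\<close>
  have stack_y: "stack \<sigma> y z \<longleftrightarrow> stack \<sigma> x z \<or> z = y" for z
  proof (cases "pt z")
    case ptz: True
    have sz: "0 < \<sigma> * sep z" using \<sigma>(1) sep_pos[OF ptz] by simp
    consider "z = y" | "before y z" | "before x z" "before z y" | "z = x" | "before z x" "z \<noteq> y"
      using before_total by blast
    then show ?thesis
    proof cases
      case 1
      then show ?thesis using sz pty before_irrefl unfolding stack_def by auto
    next
      case 2
      then have "before x z" "z \<noteq> y" using bxy before_trans before_irrefl by blast+
      then show ?thesis using 2 unfolding stack_def by blast
    next
      case 3
      then show ?thesis using uncovered[OF ptz 3] before_irrefl unfolding stack_def by blast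
    next
      case 4
      have "y \<le> x + \<sigma> * sep x" using xy(2) \<beta>h h0 unfolding h_def by linarith
      then show ?thesis unfolding 4 stack_def
        using ptx \<open>x < y\<close> before_irrefl before_asym[OF bxy] sz 4 by auto
    next
      case 5
      then have nb: "\<not> before x z" "\<not> before y z" "z \<noteq> x"
        using bxy before_asym before_trans before_irrefl by blast+
      show ?thesis
      proof (cases "z < x")
        case True
        have "y \<le> z + \<sigma> * sep z" if "x \<le> z + \<sigma> * sep z"
        proof -
          have "stack \<sigma> x z" unfolding stack_def using ptz nb that True by simp
          then have "x + 2 * h \<le> z + \<sigma> * sep z" using x nb(3) unfolding code_def h_def by blast
          then show ?thesis using xy(2) \<beta>h h0 by linarith
        qed
        moreover have "x \<le> z + \<sigma> * sep z" if "y \<le> z + \<sigma> * sep z" using that \<open>x < y\<close> by simp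
        ultimately show ?thesis unfolding stack_def using nb ptz True \<open>x < y\<close> 5(2) by auto
      next
        case False
        then have "x < z" using nb(3) by simp
        then have "\<not> z < x + \<beta>" using late ptz nb(1) by blast
        then show ?thesis unfolding stack_def using xy(2) \<open>x < z\<close> 5(2) by auto
      qed
    qed
  qed (use pty in \<open>auto simp: stack_def\<close>)
  have stack_le: "z \<le> x" if "stack \<sigma> x z" for z using that unfolding stack_def by blast
  have stack_x: "stack \<sigma> x x" unfolding stack_def using ptx before_irrefl h0 by (simp add: h_def)
  define v where "v = h / (y - x)"
  show thesis
  proof (rule that)
    show "p < v" "v < q"
      using xy \<open>x < y\<close> p0 q0 h0 unfolding v_def \<alpha>_def \<beta>_def by (simp_all add: field_simps)
    show "code_val \<sigma> y u \<longleftrightarrow> code_val \<sigma> x u \<or> u = v" for u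
    proof
      assume "code_val \<sigma> y u"
      then obtain z z' where z: "stack \<sigma> y z" "stack \<sigma> y z'" "z < z'"
        "\<not> (\<exists>w. stack \<sigma> y w \<and> z < w \<and> w < z')" "u = \<sigma> * sep z / (z' - z)" unfolding code_val_def by blast
      have "z \<noteq> y" using z(2,3) stack_y stack_le \<open>x < y\<close> by force
      then have zx: "stack \<sigma> x z" using z(1) stack_y by blast
      show "code_val \<sigma> x u \<or> u = v"
      proof (cases "z' = y")
        case True
        then have "\<not> z < x" using z(4) stack_x stack_y \<open>x < y\<close> by blast
        then have "z = x" using stack_le[OF zx] by simp
        then show ?thesis using z(5) True unfolding v_def h_def by simp
      next
        case False
        then show ?thesis using zx z stack_y unfolding code_val_def by blast
      qed
    next
      assume "code_val \<sigma> x u \<or> u = v"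
      then show "code_val \<sigma> y u"
      proof
        assume "code_val \<sigma> x u"
        then obtain z z' where z: "stack \<sigma> x z" "stack \<sigma> x z'" "z < z'"
          "\<not> (\<exists>w. stack \<sigma> x w \<and> z < w \<and> w < z')" "u = \<sigma> * sep z / (z' - z)" unfolding code_val_def by blast
        have "\<not> y < z'" using stack_le[OF z(2)] \<open>x < y\<close> by simp
        then have "\<not> (\<exists>w. stack \<sigma> y w \<and> z < w \<and> w < z')" using z(4) stack_y by blast
        then show ?thesis using z stack_y unfolding code_val_def by blast
      next
        assume u: "u = v"
        have "\<not> (\<exists>w. stack \<sigma> y w \<and> x < w \<and> w < y)" using stack_y stack_le by force
        moreover have "stack \<sigma> y x" "stack \<sigma> y y" using stack_x stack_y by blast+
        ultimately show ?thesis unfolding code_val_def u v_def h_def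
          using \<open>x < y\<close> by (intro exI[of _ x] exI[of _ y]) simp
      qed
    qed
    show "code \<sigma> y" unfolding code_def
    proof (intro conjI allI impI pty)
      fix z assume z: "stack \<sigma> y z \<and> z \<noteq> y"
      then have zx: "stack \<sigma> x z" using stack_y by blast
      have "2 * (\<sigma> * sep y) \<le> y - x" using small[OF pty ptx bxy] \<open>x < y\<close> by simp
      then have *: "y + 2 * (\<sigma> * sep y) \<le> x + h" using xy(2) \<beta>h by linarith
      show "y + 2 * (\<sigma> * sep y) \<le> z + \<sigma> * sep z"
      proof (cases "z = x")
        case True
        then show ?thesis using * unfolding h_def by simp
      next
        case False
        then have "x + 2 * h \<le> z + \<sigma> * sep z" using x zx unfolding code_def h_def by blast
        then show ?thesis using * h0 by linarith
      qed
    qed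
  qed
qed

end

section \<open>Counting with codes\<close>

text \<open>
  A chain imitates the set \<open>{2, 3, \<dots>, n}\<close> up to the error \<open>\<eta>\<close>: from one element \<open>v\<close> to the next,
  \<open>v\<close> grows by at least \<open>1\<close> and \<open>low \<eta> v\<close> by at most \<open>1\<close>. So the element in the place of \<open>k\<close> satisfies
  \<open>low \<eta> v \<le> k \<le> v\<close>, where \<open>v - \<eta> \<le> low \<eta> v\<close>, and the errors do not add up. The term \<open>\<eta> / v\<close> decreases
  in \<open>v\<close>, which leaves an interval of positive length for the choice of the next element: the next
  element \<open>v + 1 + \<theta>\<close> is admissible for all \<open>\<theta>\<close> up to \<open>\<eta> / (v * (v + 1))\<close>.
\<close>

definition low :: "'a::linordered_field \<Rightarrow> 'a \<Rightarrow> 'a" where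
  "low \<eta> v = v + \<eta> / v - \<eta>"

definition greatest :: "('a::linordered_field \<Rightarrow> bool) \<Rightarrow> 'a \<Rightarrow> bool" where
  "greatest W M \<longleftrightarrow> W M \<and> (\<forall>v. W v \<longrightarrow> v \<le> M)"

definition chain :: "'a::linordered_field \<Rightarrow> ('a \<Rightarrow> bool) \<Rightarrow> bool" where
  "chain \<eta> W \<longleftrightarrow>
     (\<exists>m. W m \<and> (\<forall>v. W v \<longrightarrow> m \<le> v) \<and> 2 \<le> m \<and> low \<eta> m \<le> 2) \<and>
     (\<exists>M. greatest W M) \<and>
     (\<forall>v u. W v \<and> W u \<and> v < u \<longrightarrow> v + 1 \<le> u) \<and>
     (\<forall>v u. W v \<and> W u \<and> v < u \<and> \<not> (\<exists>q. W q \<and> v < q \<and> q < u) \<longrightarrow> low \<eta> u \<le> low \<eta> v + 1)"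

text \<open>
  The union of the intervals \<open>[low \<eta> v, v]\<close> that contain the numbers counted by \<open>W\<close>, and everything
  that a continuation of \<open>W\<close> might reach. If \<open>W\<close> is a chain, this set contains \<open>2\<close> and is closed under adding \<open>1\<close>.
\<close>

definition cover :: "'a::linordered_field \<Rightarrow> ('a \<Rightarrow> bool) \<Rightarrow> 'a \<Rightarrow> bool" where
  "cover \<eta> W y \<longleftrightarrow> (\<exists>v. W v \<and> low \<eta> v \<le> y \<and> y \<le> v) \<or> (\<exists>M. greatest W M \<and> low \<eta> M + 1 \<le> y)"

lemma low_ge: "0 \<le> \<eta> \<Longrightarrow> 0 < v \<Longrightarrow> v - \<eta> \<le> low \<eta> v"
  unfolding low_def by simp

lemma chain_ge_2: "chain \<eta> W \<Longrightarrow> W v \<Longrightarrow> 2 \<le> v"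
  unfolding chain_def by (meson order_trans)

lemma chain_gap: "chain \<eta> W \<Longrightarrow> W v \<Longrightarrow> W u \<Longrightarrow> v < u \<Longrightarrow> v + 1 \<le> u"
  unfolding chain_def by blast

lemma pseudofinite_gapped:
  assumes "\<And>v. W v \<Longrightarrow> c \<le> v" "\<And>v. W v \<Longrightarrow> v \<le> d" "\<And>v u. W v \<Longrightarrow> W u \<Longrightarrow> v < u \<Longrightarrow> v + 1 \<le> u"
  shows "pseudofinite W"
  unfolding pseudofinite_def
proof (intro conjI)
  show "\<exists>M. \<forall>y. W y \<longrightarrow> \<bar>y\<bar> \<le> M"
  proof (intro exI allI impI)
    fix y assume "W y"
    from assms(1,2)[OF this] show "\<bar>y\<bar> \<le> max \<bar>c\<bar> \<bar>d\<bar>" by (auto simp: le_max_iff_disj abs_le_iff)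
  qed
  have "1 \<le> \<bar>y - z\<bar>" if yz: "W y" "W z" "y \<noteq> z" for y z
  proof (cases "y < z")
    case True
    then have "y + 1 \<le> z" using assms(3)[OF yz(1,2)] by blast
    then show ?thesis by (simp add: abs_if algebra_simps)
  next
    case False
    then have "z + 1 \<le> y" using assms(3)[OF yz(2,1)] yz(3) by (meson linorder_neqE)
    then show ?thesis by (simp add: abs_if algebra_simps)
  qed
  then show "\<exists>d>0. \<forall>y z. W y \<and> W z \<and> y \<noteq> z \<longrightarrow> d \<le> \<bar>y - z\<bar>"
    by (intro exI[of _ 1]) auto
qed

lemma gapped_least:
  assumes K: "definably_complete K" and W: "dpred K (\<lambda>e. W (e 0))" "W x"
    and gap: "\<And>v. W v \<Longrightarrow> c \<le> v" "\<And>v u. W v \<Longrightarrow> W u \<Longrightarrow> v < u \<Longrightarrow> v + 1 \<le> u"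
  obtains m where "W m" "\<And>v. W v \<Longrightarrow> m \<le> v"
proof -
  obtain m where m: "W m \<and> m \<le> x" "\<And>v. W v \<and> v \<le> x \<Longrightarrow> \<not> v < m"
  proof (rule pseudofinite_least[OF K])
    show "dpred K (\<lambda>e. W (e 0) \<and> e 0 \<le> x)" by (intro def_intros W(1))
    show "pseudofinite (\<lambda>v. W v \<and> v \<le> x)" by (rule pseudofinite_gapped[where c = c and d = x]) (use gap in auto)
    show "\<exists>v. W v \<and> v \<le> x" using W(2) by blast
    show "dpred K (\<lambda>e. e 0 < e 1)" by (intro def_intros)
  qed auto
  show thesis
  proof (rule that)
    show "W m" using m by blast
    show "m \<le> v" if "W v" for v
      using m(1) m(2)[of v] that by (cases "v \<le> x") auto
  qed
qed

lemma cover_step: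
  assumes K: "definably_complete K" and W: "dpred K (\<lambda>e. W (e 0))" and chain: "chain \<eta> W"
    and y: "cover \<eta> W y"
  shows "cover \<eta> W (y + 1)"
  using y unfolding cover_def
proof (elim disjE exE conjE)
  fix v assume v: "W v" "low \<eta> v \<le> y" "y \<le> v"
  show "(\<exists>v. W v \<and> low \<eta> v \<le> y + 1 \<and> y + 1 \<le> v) \<or> (\<exists>M. greatest W M \<and> low \<eta> M + 1 \<le> y + 1)"
  proof (cases "greatest W v")
    case True
    then show ?thesis using v(2) by auto
  next
    case False
    then obtain u where u: "W u" "v < u" using v(1) unfolding greatest_def by (meson not_le)
    obtain m where m: "W m \<and> v < m" "\<And>w. W w \<and> v < w \<Longrightarrow> m \<le> w"
    proof (rule gapped_least[OF K])
      show "dpred K (\<lambda>e. W (e 0) \<and> v < e 0)" by (intro def_intros W)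
      show "W u \<and> v < u" using u by blast
      show "v \<le> w" if "W w \<and> v < w" for w using that by simp
      show "w + 1 \<le> w'" if "W w \<and> v < w" "W w' \<and> v < w'" "w < w'" for w w'
        using chain_gap[OF chain] that by blast
    qed blast
    have "\<not> (\<exists>q. W q \<and> v < q \<and> q < m)" using m(2) leD by blast
    then have "low \<eta> m \<le> low \<eta> v + 1" using chain v(1) m(1) unfolding chain_def by blast
    then have "low \<eta> m \<le> y + 1" using v(2) by simp
    moreover have "y + 1 \<le> m" using chain_gap[OF chain v(1)] m(1) v(3) by force
    ultimately show ?thesis using m(1) by blast
  qed
next
  fix M assume M: "greatest W M" "low \<eta> M + 1 \<le> y"
  then have "low \<eta> M + 1 \<le> y + 1" by simp
  with M(1) show "(\<exists>v. W v \<and> low \<eta> v \<le> y + 1 \<and> y + 1 \<le> v) \<or> (\<exists>M. greatest W M \<and> low \<eta> M + 1 \<le> y + 1)"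
    by blast
qed

lemma cover_2: "chain \<eta> W \<Longrightarrow> cover \<eta> W 2"
  unfolding chain_def cover_def by blast

lemma chain_singleton:
  assumes "2 \<le> v" "low \<eta> v \<le> 2"
  shows "chain \<eta> (\<lambda>u. u = v)" "greatest (\<lambda>u. u = v) v"
  using assms unfolding chain_def greatest_def by auto

lemma chain_insert:
  assumes chain: "chain \<eta> W" and M: "greatest W M" and v: "M + 1 \<le> v" "low \<eta> v \<le> low \<eta> M + 1"
  shows "chain \<eta> (\<lambda>u. W u \<or> u = v)" "greatest (\<lambda>u. W u \<or> u = v) v"
proof -
  have le: "W u \<Longrightarrow> u \<le> M" for u using M unfolding greatest_def by blast
  have Mv: "M < v" using v(1) by (simp add: less_le_trans[OF less_add_one])
  have less: "W u \<Longrightarrow> u < v" for u using le[of u] Mv by simp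
  show g: "greatest (\<lambda>u. W u \<or> u = v) v" using less unfolding greatest_def by (auto simp: less_imp_le)
  obtain m where m: "W m" "\<And>v. W v \<Longrightarrow> m \<le> v" "2 \<le> m" "low \<eta> m \<le> 2"
    using chain unfolding chain_def by blast
  show "chain \<eta> (\<lambda>u. W u \<or> u = v)" unfolding chain_def
  proof (intro conjI allI impI)
    show "\<exists>m. (W m \<or> m = v) \<and> (\<forall>u. W u \<or> u = v \<longrightarrow> m \<le> u) \<and> 2 \<le> m \<and> low \<eta> m \<le> 2"
      using m less[OF m(1)] by (intro exI[of _ m]) (auto simp: less_imp_le)
    show "\<exists>M. greatest (\<lambda>u. W u \<or> u = v) M" using g by blast
  next
    fix w u assume *: "(W w \<or> w = v) \<and> (W u \<or> u = v) \<and> w < u"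
    then have w: "W w" using less by (metis less_asym)
    show "w + 1 \<le> u"
    proof (cases "W u")
      case True
      then show ?thesis using chain_gap[OF chain w] * by blast
    next
      case False
      then have "u = v" using * by blast
      then show ?thesis using le[OF w] v(1) by (metis add_right_mono order_trans)
    qed
  next
    fix w u
    assume *: "(W w \<or> w = v) \<and> (W u \<or> u = v) \<and> w < u \<and> \<not> (\<exists>q. (W q \<or> q = v) \<and> w < q \<and> q < u)"
    then have w: "W w" using less by (metis less_asym)
    show "low \<eta> u \<le> low \<eta> w + 1"
    proof (cases "W u")
      case True
      then show ?thesis using chain w * unfolding chain_def by blast
    next
      case False
      then have u: "u = v" using * by blast
      have "W M" using M unfolding greatest_def by blast
      then have "\<not> w < M" using * u Mv by blast
      then have "w = M" using le[OF w] by simp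
      then show ?thesis using v(2) u by simp
    qed
  qed
qed

text \<open>
  \<open>N\<close> consists of the numbers that lie in \<open>cover \<eta> W\<close> for all coded chains \<open>W\<close> and that are reached,
  within every error \<open>\<eta>\<close>, by codes for all sufficiently small \<open>\<sigma>\<close>. The first condition is inherited
  by successors because \<open>cover\<close> is, the second one because codes can be extended; \<open>\<sigma>\<close> has to be small
  in comparison with the room for the next element. Codes with small \<open>\<eta>\<close> reaching beyond two
  elements of \<open>N\<close> show that their distance is at least \<open>1 - \<eta>\<close> unless it is at most \<open>\<eta>\<close>.
\<close>

lemma definable_progression:
  fixes K :: "('f, 'r, 'a::linordered_field) expansion"
  assumes K: "definably_complete K"
    and code_d: "dpred K (\<lambda>e. code (e 0) (e 1))" and val_d: "dpred K (\<lambda>e. code_val (e 0) (e 1) (e 2))"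
    and initial: "\<And>\<sigma>. \<exists>x. code \<sigma> x \<and> (\<forall>v. \<not> code_val \<sigma> x v)"
    and extend: "\<And>\<sigma> x p q. 0 < \<sigma> \<Longrightarrow> \<sigma> \<le> 1 / 2 \<Longrightarrow> code \<sigma> x \<Longrightarrow> 2 \<le> p \<Longrightarrow> (1 + 2 * \<sigma>) * p < q \<Longrightarrow>
      \<exists>x' v. code \<sigma> x' \<and> p < v \<and> v < q \<and> (\<forall>u. code_val \<sigma> x' u \<longleftrightarrow> code_val \<sigma> x u \<or> u = v)"
  obtains N where "dpred K (\<lambda>e. N (e 0))" "N 2" "\<And>y. N y \<Longrightarrow> N (y + 1)"
    "\<And>y y'. N y \<Longrightarrow> N y' \<Longrightarrow> y < y' \<Longrightarrow> y + 1 \<le> y'"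
proof -
  define good where "good \<eta> \<sigma> y \<longleftrightarrow> (\<exists>x. code \<sigma> x \<and> chain \<eta> (code_val \<sigma> x) \<and>
      (\<exists>M. greatest (code_val \<sigma> x) M \<and> low \<eta> M \<le> y \<and> y \<le> M))" for \<eta> \<sigma> y
  define N where "N y \<longleftrightarrow>
      (\<forall>\<eta> \<sigma> x. 0 < \<eta> \<and> \<eta> < 1 \<and> chain \<eta> (code_val \<sigma> x) \<longrightarrow> cover \<eta> (code_val \<sigma> x) y) \<and>
      (\<forall>\<eta>. 0 < \<eta> \<and> \<eta> < 1 \<longrightarrow> (\<exists>s>0. \<forall>\<sigma>. 0 < \<sigma> \<and> \<sigma> < s \<longrightarrow> good \<eta> \<sigma> y))" for y
  have code: "dpred K (\<lambda>e. code (s e) (t e))" if "dfun K s" "dfun K t" for s t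
    by (rule dpred_subst2[OF code_d that])
  have code_val: "dpred K (\<lambda>e. code_val (s e) (t e) (u e))" if "dfun K s" "dfun K t" "dfun K u" for s t u
    by (rule dpred_subst3[OF val_d that])
  have vald: "dpred K (\<lambda>e. code_val \<sigma> x (e 0))" for \<sigma> x by (intro code_val def_intros)
  have "dpred K (\<lambda>e. N (e 0))"
    unfolding N_def good_def chain_def cover_def greatest_def low_def by (intro def_intros code code_val)
  moreover have "N 2" unfolding N_def
  proof (intro conjI allI impI)
    show "cover \<eta> (code_val \<sigma> x) 2" if "0 < \<eta> \<and> \<eta> < 1 \<and> chain \<eta> (code_val \<sigma> x)" for \<eta> \<sigma> x
      using that cover_2 by blast
    fix \<eta> :: 'a assume \<eta>: "0 < \<eta> \<and> \<eta> < 1"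
    show "\<exists>s>0. \<forall>\<sigma>. 0 < \<sigma> \<and> \<sigma> < s \<longrightarrow> good \<eta> \<sigma> 2"
    proof (intro exI conjI allI impI)
      show "\<eta> / 16 > 0" using \<eta> by simp
      fix \<sigma> assume \<sigma>: "0 < \<sigma> \<and> \<sigma> < \<eta> / 16"
      obtain x where x: "code \<sigma> x" "\<forall>v. \<not> code_val \<sigma> x v" using initial by blast
      have "\<sigma> \<le> 1 / 2" "(1 + 2 * \<sigma>) * 2 < 2 + \<eta> / 2" using \<sigma> \<eta> by (simp_all add: field_simps)
      then obtain x' v where v: "code \<sigma> x'" "2 < v" "v < 2 + \<eta> / 2" "\<forall>u. code_val \<sigma> x' u \<longleftrightarrow> code_val \<sigma> x u \<or> u = v"
        using extend[of \<sigma> x 2 "2 + \<eta> / 2"] \<sigma> x(1) by blast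
      have W: "code_val \<sigma> x' = (\<lambda>u. u = v)" using v(4) x(2) by blast
      have "\<eta> / v \<le> \<eta> / 2" using v(2) \<eta> by (intro divide_left_mono) auto
      then have low: "low \<eta> v \<le> 2" unfolding low_def using v(3) field_sum_of_halves[of \<eta>] by linarith
      have "2 \<le> v" using v(2) by simp
      then show "good \<eta> \<sigma> 2" unfolding good_def
        using v(1) chain_singleton[OF _ low] low W by metis
    qed
  qed
  moreover have "N (y + 1)" if y: "N y" for y
    unfolding N_def
  proof (intro conjI allI impI)
    show "cover \<eta> (code_val \<sigma> x) (y + 1)" if "0 < \<eta> \<and> \<eta> < 1 \<and> chain \<eta> (code_val \<sigma> x)" for \<eta> \<sigma> x
      using that y cover_step[OF K vald] unfolding N_def by blast
    fix \<eta> :: 'a assume \<eta>: "0 < \<eta> \<and> \<eta> < 1"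
    then obtain s where s: "s > 0" "\<And>\<sigma>. 0 < \<sigma> \<Longrightarrow> \<sigma> < s \<Longrightarrow> good \<eta> \<sigma> y"
      using y unfolding N_def by blast
    \<comment> \<open>A bound, depending on \<open>y\<close> only, for \<open>M + 1\<close> where \<open>M\<close> is the last element of any chain reaching \<open>y\<close>.\<close>
    define c where "c = \<bar>y\<bar> + 2"
    have c: "2 \<le> c" unfolding c_def by simp
    define r where "r = \<eta> / (2 * (c * c * c))"
    have ccc: "0 < c * c * c" using c by (intro mult_pos_pos) auto
    show "\<exists>s>0. \<forall>\<sigma>. 0 < \<sigma> \<and> \<sigma> < s \<longrightarrow> good \<eta> \<sigma> (y + 1)"
    proof (intro exI conjI allI impI)
      show "min s (min r (1 / 2)) > 0" using s(1) \<eta> ccc unfolding r_def by simp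
      fix \<sigma> assume \<sigma>: "0 < \<sigma> \<and> \<sigma> < min s (min r (1 / 2))"
      then obtain x M where x: "code \<sigma> x" "chain \<eta> (code_val \<sigma> x)" "greatest (code_val \<sigma> x) M" "low \<eta> M \<le> y" "y \<le> M"
        using s(2)[of \<sigma>] unfolding good_def by auto
      have M2: "2 \<le> M" using chain_ge_2[OF x(2)] x(3) unfolding greatest_def by blast
      then have M0: "0 < M" by simp
      have "M - \<eta> \<le> y" using low_ge[of \<eta> M] \<eta> M0 x(4) by simp
      then have Mc: "M + 1 < c" unfolding c_def using \<eta> by (simp add: abs_if split: if_splits)
      define \<theta> where "\<theta> = \<eta> / (M * (M + 1))"
      have "M * (M + 1) < c * c" using M0 Mc by (intro mult_strict_mono) auto
      then have "\<eta> / (c * c) < \<theta>" unfolding \<theta>_def using \<eta> M0 by (intro divide_strict_left_mono mult_pos_pos) (use c in auto)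
      moreover have "2 * \<sigma> * (M + 1) < 2 * r * c"
        by (rule mult_strict_mono) (use \<sigma> Mc M0 c in auto)
      moreover have "2 * r * c = \<eta> / (c * c)" unfolding r_def using c by (simp add: field_simps)
      ultimately have "2 * \<sigma> * (M + 1) < \<theta>" by simp
      then have "(1 + 2 * \<sigma>) * (M + 1) < M + 1 + \<theta>" by (simp add: algebra_simps)
      then obtain x' v where v: "code \<sigma> x'" "M + 1 < v" "v < M + 1 + \<theta>"
        "\<forall>u. code_val \<sigma> x' u \<longleftrightarrow> code_val \<sigma> x u \<or> u = v"
        using extend[of \<sigma> x "M + 1" "M + 1 + \<theta>"] \<sigma> x(1) M2 by auto
      have W: "code_val \<sigma> x' = (\<lambda>u. code_val \<sigma> x u \<or> u = v)" using v(4) by blast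
      have "\<eta> / v \<le> \<eta> / (M + 1)" using v(2) \<eta> M0 by (intro divide_left_mono mult_pos_pos) auto
      moreover have "\<theta> + \<eta> / (M + 1) = \<eta> / M"
        unfolding \<theta>_def using M0 by (simp add: divide_simps) (simp add: algebra_simps)
      ultimately have low: "low \<eta> v \<le> low \<eta> M + 1" unfolding low_def using v(3) by (simp add: algebra_simps)
      have "chain \<eta> (code_val \<sigma> x')" "greatest (code_val \<sigma> x') v"
        unfolding W using chain_insert[OF x(2,3) _ low] v(2) by simp_all
      moreover have "low \<eta> v \<le> y + 1" "y + 1 \<le> v" using low x(4,5) v(2) by simp_all
      ultimately show "good \<eta> \<sigma> (y + 1)" unfolding good_def using v(1) by blast
    qed
  qed
  moreover have "y + 1 \<le> y'" if N: "N y" "N y'" and yy: "y < y'" for y y'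
  proof (rule ccontr)
    assume "\<not> ?thesis"
    then have yy': "y' < y + 1" by simp
    then have "0 < min 1 (min (y' - y) (y + 1 - y'))" using yy by simp
    from dense[OF this] obtain \<eta>
      where \<eta>: "0 < \<eta> \<and> \<eta> < 1" and \<eta>1: "\<eta> < y' - y" and \<eta>2: "\<eta> < y + 1 - y'" by auto
    \<comment> \<open>A chain reaching \<open>y + 2\<close> covers \<open>y\<close> and \<open>y'\<close> by its intervals and not by its tail.\<close>
    have "N (y + 1 + 1)" using \<open>\<And>y. N y \<Longrightarrow> N (y + 1)\<close> N(1) by blast
    then obtain s where s: "s > 0" "\<And>\<sigma>. 0 < \<sigma> \<Longrightarrow> \<sigma> < s \<Longrightarrow> good \<eta> \<sigma> (y + 1 + 1)"
      using \<eta> unfolding N_def by blast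
    then have "good \<eta> (s / 2) (y + 1 + 1)" by simp
    then obtain x M where x: "chain \<eta> (code_val (s / 2) x)" "greatest (code_val (s / 2) x) M" "y + 1 + 1 \<le> M"
      unfolding good_def by blast
    define W where "W = code_val (s / 2) x"
    have low: "v - \<eta> \<le> low \<eta> v" if "W v" for v
      using low_ge[of \<eta> v] \<eta> chain_ge_2[OF x(1)] that unfolding W_def by force
    have tail: "\<not> low \<eta> M' + 1 \<le> z" if "greatest W M'" "z \<le> y'" for M' z
    proof
      assume a: "low \<eta> M' + 1 \<le> z"
      have "M' = M" using that(1) x(2) unfolding greatest_def W_def by (meson antisym)
      moreover have "W M'" using that(1) unfolding greatest_def by blast
      ultimately have "M - \<eta> + 1 \<le> z" using low[of M'] a by simp
      then have "y + 1 + 1 - \<eta> + 1 \<le> y'" using x(3) that(2) by simp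
      then show False using yy' \<eta> by simp
    qed
    have "cover \<eta> W y" "cover \<eta> W y'" using N \<eta> x(1) unfolding N_def W_def by blast+
    then obtain v u where v: "W v" "low \<eta> v \<le> y" "y \<le> v" and u: "W u" "low \<eta> u \<le> y'" "y' \<le> u"
      using tail yy unfolding cover_def by (metis less_imp_le order_refl)
    have v': "v - \<eta> \<le> y" and u': "u - \<eta> \<le> y'" using low[OF v(1)] low[OF u(1)] v u by simp_all
    consider "v = u" | "v < u" | "u < v" by fastforce
    then show False
    proof cases
      case 1
      then have "y' - \<eta> \<le> y" using v' u(3) by simp
      then show False using \<eta>1 by (simp add: algebra_simps)
    next
      case 2
      then have "v + 1 \<le> u" using chain_gap[OF x(1)] v(1) u(1) unfolding W_def by blast
      then have "y + 1 - \<eta> \<le> y'" using u' v(3) by simp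
      then show False using \<eta>2 by (simp add: algebra_simps)
    next
      case 3
      then have "u + 1 \<le> v" using chain_gap[OF x(1)] v(1) u(1) unfolding W_def by blast
      then have "y' + 1 - \<eta> \<le> y" using v' u(3) by simp
      then show False using \<eta> yy by simp
    qed
  qed
  ultimately show thesis by (rule that)
qed

section \<open>From counting to a discrete subring\<close>

text \<open>
  The non-negative part of the ring consists, after a shift by \<open>2\<close>, of those elements \<open>y \<ge> 2\<close> of \<open>N\<close>
  such that every element of \<open>N\<close> between \<open>2\<close> and \<open>y\<close>, other than \<open>2\<close>, has its predecessor in \<open>N\<close>. They satisfy induction for definable predicates, because bounded
  sets with gaps \<open>1\<close> are pseudo-finite; closure under the ring operations follows as in Peano
  arithmetic.
\<close>

lemma discrete_subring_of_progression:
  fixes K :: "('f, 'r, 'a::{linordered_field, linorder_topology}) expansion"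
  assumes K: "definably_complete K"
    and N_d: "dpred K (\<lambda>e. N (e 0))" and N2: "N 2" and N_succ: "\<And>y. N y \<Longrightarrow> N (y + 1)"
    and N_gap: "\<And>y y'. N y \<Longrightarrow> N y' \<Longrightarrow> y < y' \<Longrightarrow> y + 1 \<le> y'"
  shows "\<exists>R :: 'a set. definable1 K R \<and> unital_subring R \<and> discrete R"
proof -
  define M where "M x \<longleftrightarrow> 0 \<le> x \<and> N (x + 2) \<and> (\<forall>z. N z \<and> 2 \<le> z \<and> z \<le> x + 2 \<longrightarrow> z = 2 \<or> N (z - 1))" for x
  have N: "dpred K (\<lambda>e. N (s e))" if "dfun K s" for s by (rule dpred_subst1[OF N_d that])
  have M0: "dpred K (\<lambda>e. M (e 0))" unfolding M_def by (intro def_intros N)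
  have Md: "dpred K (\<lambda>e. M (s e))" if "dfun K s" for s by (rule dpred_subst1[OF M0 that])
  have zero: "M 0" unfolding M_def using N2 by auto
  have nonneg: "0 \<le> x" if "M x" for x using that unfolding M_def by blast
  have gap: "x + 1 \<le> y" if "M x" "M y" "x < y" for x y
    using N_gap[of "x + 2" "y + 2"] that unfolding M_def by (simp add: algebra_simps)
  have succ: "M (x + 1)" if "M x" for x
    unfolding M_def
  proof (intro conjI allI impI)
    show "0 \<le> x + 1" using nonneg[OF that] by simp
    have "N (x + 2 + 1)" using N_succ that unfolding M_def by blast
    then show "N (x + 1 + 2)" by (simp add: algebra_simps)
    fix z assume z: "N z \<and> 2 \<le> z \<and> z \<le> x + 1 + 2"
    show "z = 2 \<or> N (z - 1)"
    proof (cases "z \<le> x + 2")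
      case True
      then show ?thesis using that z unfolding M_def by blast
    next
      case False
      then have "x + 2 + 1 \<le> z" using N_gap[of "x + 2" z] that z unfolding M_def by simp
      then have "z - 1 = x + 2" using z by (simp add: algebra_simps)
      moreover have "N (x + 2)" using that unfolding M_def by blast
      ultimately show ?thesis by metis
    qed
  qed
  have pred: "M (x - 1)" if "M x" "x \<noteq> 0" for x
  proof -
    have "0 < x" using nonneg[OF that(1)] that(2) by simp
    then have "1 \<le> x" using gap[OF zero that(1)] by simp
    moreover have "N (x + 2 - 1)" using that unfolding M_def by force
    moreover have "z \<le> x + 2" if "z \<le> x - 1 + 2" for z using that by (rule order_trans) simp
    ultimately show ?thesis using that(1) unfolding M_def by (auto simp: algebra_simps)
  qed
  have induct: "Q y" if Qd: "dpred K (\<lambda>e. Q (e 0))" and Q0: "Q 0"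
    and Qs: "\<And>x. M x \<Longrightarrow> Q x \<Longrightarrow> Q (x + 1)" and y: "M y" for Q y
  proof (rule ccontr)
    assume "\<not> Q y"
    obtain m where m: "M m \<and> \<not> Q m" "\<And>v. M v \<and> \<not> Q v \<Longrightarrow> m \<le> v"
    proof (rule gapped_least[OF K])
      show "dpred K (\<lambda>e. M (e 0) \<and> \<not> Q (e 0))" by (intro def_intros Md Qd)
      show "M y \<and> \<not> Q y" using y \<open>\<not> Q y\<close> by blast
      show "0 \<le> v" if "M v \<and> \<not> Q v" for v using that nonneg by blast
      show "v + 1 \<le> u" if "M v \<and> \<not> Q v" "M u \<and> \<not> Q u" "v < u" for u v using that gap by blast
    qed blast
    have "m \<noteq> 0" using m(1) Q0 by blast
    then have "M (m - 1)" using pred m(1) by blast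
    moreover have "\<not> m \<le> m - 1" by simp
    ultimately have "Q (m - 1)" using m(2) by blast
    then have "Q (m - 1 + 1)" using Qs \<open>M (m - 1)\<close> by blast
    then show False using m(1) by simp
  qed
  have add: "M (x + y)" if "M x" "M y" for x y
  proof (rule induct[OF _ _ _ that(2)])
    show "dpred K (\<lambda>e. M (x + e 0))" by (intro Md def_intros)
    show "M (x + 0)" using that by simp
    show "M (x + (z + 1))" if "M (x + z)" for z using succ[OF that] by (simp add: add.assoc)
  qed
  have mult: "M (x * y)" if "M x" "M y" for x y
  proof (rule induct[OF _ _ _ that(2)])
    show "dpred K (\<lambda>e. M (x * e 0))" by (intro Md def_intros)
    show "M (x * 0)" using zero by simp
    show "M (x * (z + 1))" if "M (x * z)" for z
      using add[OF that \<open>M x\<close>] by (simp add: distrib_left)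
  qed
  have diff: "M (x - y) \<or> M (y - x)" if "M x" "M y" for x y
  proof (rule induct[OF _ _ _ that(2)])
    show "dpred K (\<lambda>e. M (x - e 0) \<or> M (e 0 - x))" by (intro Md def_intros)
    show "M (x - 0) \<or> M (0 - x)" using that by simp
    fix z assume "M (x - z) \<or> M (z - x)"
    then show "M (x - (z + 1)) \<or> M (z + 1 - x)"
    proof
      assume a: "M (x - z)"
      show ?thesis
      proof (cases "x - z = 0")
        case True
        then have "z + 1 - x = 0 + 1" by simp
        then show ?thesis using succ[OF zero] by simp
      next
        case False
        then have "M (x - z - 1)" using pred a by blast
        then show ?thesis by (simp add: diff_diff_eq)
      qed
    next
      assume "M (z - x)"
      from succ[OF this] show ?thesis by (simp add: algebra_simps)
    qed
  qed
  define R where "R = {x. M x \<or> M (- x)}"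
  have R_add: "x + y \<in> R" if "x \<in> R" "y \<in> R" for x y
  proof -
    have eqs: "- y - x = - (x + y)" "- x - y = - (x + y)" "- x + - y = - (x + y)"
      "y - - x = x + y" "x - - y = x + y" by simp_all
    have "M (x + y) \<or> M (- (x + y))"
      using that add[of x y] add[of "- x" "- y"] diff[of x "- y"] diff[of y "- x"]
      unfolding R_def eqs mem_Collect_eq by blast
    then show ?thesis unfolding R_def by simp
  qed
  have R_mult: "x * y \<in> R" if "x \<in> R" "y \<in> R" for x y
    using that mult[of x y] mult[of "- x" "- y"] mult[of x "- y"] mult[of "- x" y] unfolding R_def by auto
  have R_uminus: "- x \<in> R" if "x \<in> R" for x using that unfolding R_def by auto
  have R_gap: "\<not> (0 < x \<and> x < 1)" if "x \<in> R" for x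
    using that nonneg gap[OF zero] unfolding R_def by force
  show ?thesis
  proof (intro exI conjI)
    show "definable1 K R" unfolding R_def by (rule dpred_definable1) (intro def_intros Md)
    show "unital_subring R" unfolding unital_subring_def
      using R_add R_mult R_uminus zero succ[OF zero] by (auto simp: R_def)
    show "discrete R"
    proof (rule discreteI)
      fix x assume x: "x \<in> R"
      have "{x - 1<..<x + 1} \<inter> R = {x}"
      proof (intro equalityI subsetI)
        fix y assume y: "y \<in> {x - 1<..<x + 1} \<inter> R"
        then have "y + - x \<in> R" "x + - y \<in> R" using x R_add R_uminus by blast+
        then have "\<not> (0 < y - x \<and> y - x < 1)" "\<not> (0 < x - y \<and> x - y < 1)" using R_gap by fastforce+
        then show "y \<in> {x}" using y by (auto simp: algebra_simps)
      qed (use x in auto)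
      then show "x isolated_in R" unfolding isolated_in_def
        using x open_greaterThanLessThan by blast
    qed
  qed
qed

section \<open>The dichotomy\<close>

theorem theoremA:
  fixes K :: "('f, 'r, 'a::{linordered_field, linorder_topology}) expansion"
  assumes "definably_complete K"
  shows "(\<forall>n (D :: (nat \<Rightarrow> 'a) set) (f :: (nat \<Rightarrow> 'a) \<Rightarrow> 'a).
            definable K n D \<and> discrete_in_power n D \<and> definable_fun K n f
              \<longrightarrow> nowhere_dense (f ` D))
       \<or> (\<exists>R :: 'a set. definable1 K R \<and> unital_subring R \<and> discrete R)"
proof (rule disjCI)
  assume no_subring: "\<not> (\<exists>R :: 'a set. definable1 K R \<and> unital_subring R \<and> discrete R)"
  show "\<forall>n (D :: (nat \<Rightarrow> 'a) set) (f :: (nat \<Rightarrow> 'a) \<Rightarrow> 'a).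
      definable K n D \<and> discrete_in_power n D \<and> definable_fun K n f \<longrightarrow> nowhere_dense (f ` D)"
  proof (intro allI impI, elim conjE, rule ccontr)
    fix n and D :: "(nat \<Rightarrow> 'a) set" and f :: "(nat \<Rightarrow> 'a) \<Rightarrow> 'a"
    assume D: "definable K n D" "discrete_in_power n D" "definable_fun K n f" "\<not> nowhere_dense (f ` D)"
    obtain A a b where "exhausted_dense_set K A a b"
      by (rule dense_image_exhaustion[OF assms D])
    then interpret exhausted_dense_set K A a b .
    show False
    proof (rule definable_progression[of K code code_val])
      show "definably_complete K" by (rule assms)
      show "dpred K (\<lambda>e. code (e 0) (e 1))" by (intro code_def_intro dfun_var)
      show "dpred K (\<lambda>e. code_val (e 0) (e 1) (e 2))" by (intro code_val_def_intro dfun_var)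
      show "\<exists>x. code \<sigma> x \<and> (\<forall>v. \<not> code_val \<sigma> x v)" for \<sigma>
        by (rule code_initial) blast
      show "\<exists>x' v. code \<sigma> x' \<and> p < v \<and> v < q \<and> (\<forall>u. code_val \<sigma> x' u \<longleftrightarrow> code_val \<sigma> x u \<or> u = v)"
        if "0 < \<sigma>" "\<sigma> \<le> 1 / 2" "code \<sigma> x" "2 \<le> p" "(1 + 2 * \<sigma>) * p < q" for \<sigma> x p q
        by (rule code_extend[OF that]) blast
      fix N assume N: "dpred K (\<lambda>e. N (e 0))" "N 2" "\<And>y. N y \<Longrightarrow> N (y + 1)"
        "\<And>y y'. N y \<Longrightarrow> N y' \<Longrightarrow> y < y' \<Longrightarrow> y + 1 \<le> y'"
      show False
        using discrete_subring_of_progression[of K N, OF assms N] no_subring by blast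
    qed
  qed
qed

end
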